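(* Let $\Sigma=\{\sigma_1,\ldots,\sigma_n\}$ be a semigroup of maps on $\{1,\ldots,N\}$, let $V$ be a finite dimensional real vector space and let $f_0\in L(V^n,V)$. Let $f_0^S,f_0^N\in L(V^n,V)$ be such that $\gamma_{f_0^S}=\gamma_{f_0}^S$ and $\gamma_{f_0^N}=\gamma_{f_0}^N$. For every $k=0,1,2,\ldots$ the maps $$(\mathrm{ad}^\Sigma_{f_0}|_{P^k})^S\ \text{ and }\ \mathrm{ad}^\Sigma_{f_0^S}\big|_{P^k},\quad\text{respectively}\quad (\mathrm{ad}^\Sigma_{f_0}|_{P^k})^N\ \text{ and }\ \mathrm{ad}^\Sigma_{f_0^N}\big|_{P^k},$$ descend to the same map on $P^k/\ker\gamma$.
   Context: $N,n\ge 1$ are integers and $\Sigma=\{\sigma_1,\ldots,\sigma_n\}$ is a collection of $n$ distinct maps $\sigma_j:\{1,\ldots,N\}\to\{1,\ldots,N\}$. $\Sigma$ is called a semigroup if for all $1\le j_1,j_2\le n$ there is a unique $1\le j_3\le n$ with $\sigma_{j_1}\circ\sigma_{j_2}=\sigma_{j_3}$. In that case $\widetilde\sigma_j:\{1,\ldots,n\}\to\{1,\ldots,n\}$ is determined by $\sigma_{\widetilde\sigma_j(k)}=\sigma_j\circ\sigma_k$, and $A_{\sigma_j}(X_1,\ldots,X_n)=(X_{\widetilde\sigma_1(j)},\ldots,X_{\widetilde\sigma_n(j)})$ on $V^n$. For $f\in C^\infty(V^n,V)$, $\gamma_f:V^N\to V^N$ is $(\gamma_f)_i(x)=f(x_{\sigma_1(i)},\ldots,x_{\sigma_n(i)})$;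 $\gamma$ is the linear map $f\mapsto\gamma_f$, with kernel $\ker\gamma=\{h\in C^\infty(V^n,V)\mid\gamma_h=0\}$. With $D_j$ the partial derivative with respect to the $j$-th argument in $V$, $\mathrm{ad}^\Sigma_f(g)=[f,g]_\Sigma=\sum_{j=1}^n D_jf\cdot(g\circ A_{\sigma_j})-D_jg\cdot(f\circ A_{\sigma_j})$. $L(V^n,V)$ is the space of linear maps, and $P^k$ the (finite dimensional) space of homogeneous polynomial maps $V^n\to V$ of degree $k+1$; $\mathrm{ad}^\Sigma_{f_0}$ maps $P^k$ to itself for linear $f_0$. $P^k/\ker\gamma$ means $P^k/(P^k\cap\ker\gamma)$. For a linear endomorphism $T$ of a finite dimensional real vector space, $T=T^S+T^N$ denotes its SN- (Jordan–Chevalley) decomposition: $T^S$ semisimple, $T^N$ nilpotent, $T^ST^N=T^NT^S$. In particular, $\gamma_{f_0}\in L(V^N,V^N)$ has the decomposition $\gamma_{f_0}=\gamma_{f_0}^S+\gamma_{f_0}^N$. A map "descends" to $P^k/\ker\gamma$ if it sends $P^k\cap\ker\gamma$ into itself. *)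

theory Defs
  imports "HOL-Analysis.Analysis" "HOL-Library.Function_Algebras" "HOL-Library.FuncSet"
begin

section \<open>Vector spaces of maps\<close>

(* Function_Algebras supplies the pointwise additive group; with scaleR the library's
   subspace, span and linear apply to spaces of maps such as C^infinity(V^n, V). *)

instantiation "fun" :: (type, scaleR) scaleR
begin

definition scaleR_fun :: "real \<Rightarrow> ('a \<Rightarrow> 'b) \<Rightarrow> 'a \<Rightarrow> 'b"
  where "scaleR_fun c f = (\<lambda>x. c *\<^sub>R f x)"

instance ..

end

instance "fun" :: (type, real_vector) real_vector
  by standard (simp_all add: scaleR_fun_def plus_fun_def fun_eq_iff algebra_simps)

definition finite_dimensional :: "'a::real_vector itself \<Rightarrow> bool"
  where "finite_dimensional _ \<longleftrightarrow> (\<exists>B::'a set. finite B \<and> span B = UNIV)"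


section \<open>SN-decomposition of an endomorphism of a subspace\<close>

definition endomorphism_on :: "'a::real_vector set \<Rightarrow> ('a \<Rightarrow> 'a) \<Rightarrow> bool"
  where "endomorphism_on W T \<longleftrightarrow>
    T \<in> W \<rightarrow> W \<and> (\<forall>x\<in>W. \<forall>y\<in>W. T (x + y) = T x + T y) \<and> (\<forall>c. \<forall>x\<in>W. T (c *\<^sub>R x) = c *\<^sub>R T x)"

definition semisimple_on :: "'a::real_vector set \<Rightarrow> ('a \<Rightarrow> 'a) \<Rightarrow> bool"
  where "semisimple_on W T \<longleftrightarrow>
    (\<forall>U. subspace U \<and> U \<subseteq> W \<and> T ` U \<subseteq> U \<longrightarrow>
      (\<exists>U'. subspace U' \<and> U' \<subseteq> W \<and> T ` U' \<subseteq> U' \<and> U \<inter> U' = {0} \<and>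
            W = {u + u' | u u'. u \<in> U \<and> u' \<in> U'}))"

definition nilpotent_on :: "'a::real_vector set \<Rightarrow> ('a \<Rightarrow> 'a) \<Rightarrow> bool"
  where "nilpotent_on W T \<longleftrightarrow> (\<exists>m::nat. \<forall>x\<in>W. (T ^^ m) x = 0)"

definition SN_decomposition ::
    "'a::real_vector set \<Rightarrow> ('a \<Rightarrow> 'a) \<Rightarrow> ('a \<Rightarrow> 'a) \<Rightarrow> ('a \<Rightarrow> 'a) \<Rightarrow> bool"
  where "SN_decomposition W T S N \<longleftrightarrow>
    endomorphism_on W S \<and> endomorphism_on W N \<and> semisimple_on W S \<and> nilpotent_on W N \<and>
    (\<forall>x\<in>W. T x = S x + N x) \<and> (\<forall>x\<in>W. S (N x) = N (S x))"

(* The parts T^S and T^N of the endomorphism T of the finite dimensional subspace W. Only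
   values on W matter; extensional fixes the values elsewhere, so that the (unique)
   endomorphism of W is a unique HOL function. *)

definition semisimple_part :: "'a::real_vector set \<Rightarrow> ('a \<Rightarrow> 'a) \<Rightarrow> 'a \<Rightarrow> 'a"
  where "semisimple_part W T = (THE S. S \<in> extensional W \<and> (\<exists>N. SN_decomposition W T S N))"

definition nilpotent_part :: "'a::real_vector set \<Rightarrow> ('a \<Rightarrow> 'a) \<Rightarrow> 'a \<Rightarrow> 'a"
  where "nilpotent_part W T = (THE N. N \<in> extensional W \<and> (\<exists>S. SN_decomposition W T S N))"


section \<open>Maps on quotient spaces\<close>

(* The elements of W / (W \<inter> K) are the classes W // congruence_mod W K. *)

definition congruence_mod :: "'a::real_vector set \<Rightarrow> 'a set \<Rightarrow> 'a rel"
  where "congruence_mod W K = {(x, y). x \<in> W \<and> y \<in> W \<and> x - y \<in> K}"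

definition descends :: "'a::real_vector set \<Rightarrow> 'a set \<Rightarrow> ('a \<Rightarrow> 'a) \<Rightarrow> bool"
  where "descends W K T \<longleftrightarrow> endomorphism_on W T \<and> T \<in> W \<inter> K \<rightarrow> W \<inter> K"

definition quotient_map :: "'a::real_vector set \<Rightarrow> 'a set \<Rightarrow> ('a \<Rightarrow> 'a) \<Rightarrow> 'a set \<Rightarrow> 'a set"
  where "quotient_map W K T C = (\<Union>x\<in>C. congruence_mod W K `` {T x})"

definition descend_to_same ::
    "'a::real_vector set \<Rightarrow> 'a set \<Rightarrow> ('a \<Rightarrow> 'a) \<Rightarrow> ('a \<Rightarrow> 'a) \<Rightarrow> bool"
  where "descend_to_same W K T T' \<longleftrightarrow>
    descends W K T \<and> descends W K T' \<and>
    (\<forall>C \<in> W // congruence_mod W K. quotient_map W K T C = quotient_map W K T' C)"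


section \<open>Smooth and homogeneous polynomial maps\<close>

(* On a finite dimensional space, C^r in the usual sense follows from differentiability of all
   iterated directional derivatives of order at most r. *)

primrec times_differentiable :: "nat \<Rightarrow> ('a::real_normed_vector \<Rightarrow> 'b::real_normed_vector) \<Rightarrow> bool"
  where
    "times_differentiable 0 f \<longleftrightarrow> continuous_on UNIV f"
  | "times_differentiable (Suc r) f \<longleftrightarrow> (\<forall>x. f differentiable (at x)) \<and>
      (\<forall>v. times_differentiable r (\<lambda>x. frechet_derivative f (at x) v))"

definition smooth_maps :: "('a::real_normed_vector \<Rightarrow> 'b::real_normed_vector) set"
  where "smooth_maps = {f. \<forall>r. times_differentiable r f}"

(* Homogeneous polynomial maps of degree d: in coordinates, the monomials of degree d times
   vectors are among the generators, and products of d linear forms are combinations of them. *)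

definition homogeneous_polynomial_maps :: "nat \<Rightarrow> ('a::real_vector \<Rightarrow> 'b::real_vector) set"
  where "homogeneous_polynomial_maps d =
    span {\<lambda>x. (\<Prod>i<d. l i x) *\<^sub>R v | (l :: nat \<Rightarrow> 'a \<Rightarrow> real) (v :: 'b). \<forall>i<d. linear (l i)}"

abbreviation P_space :: "nat \<Rightarrow> ('v::real_vector ^ 'n \<Rightarrow> 'v) set"
  where "P_space k \<equiv> homogeneous_polynomial_maps (Suc k)"


section \<open>Semigroup coupled cell networks\<close>

(* The cells 1..N are the elements of the finite type 'N, the indices 1..n those of 'n. *)

definition semigroup_of_maps :: "('n \<Rightarrow> 'N \<Rightarrow> 'N) \<Rightarrow> bool"
  where "semigroup_of_maps \<sigma> \<longleftrightarrow> (\<forall>j1 j2. \<exists>!j3. \<sigma> j1 \<circ> \<sigma> j2 = \<sigma> j3)"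

definition sigma_tilde :: "('n \<Rightarrow> 'N \<Rightarrow> 'N) \<Rightarrow> 'n \<Rightarrow> 'n \<Rightarrow> 'n"
  where "sigma_tilde \<sigma> j k = (THE l. \<sigma> l = \<sigma> j \<circ> \<sigma> k)"

definition A_map :: "('n \<Rightarrow> 'N \<Rightarrow> 'N) \<Rightarrow> 'n \<Rightarrow> 'v ^ 'n \<Rightarrow> 'v ^ 'n"
  where "A_map \<sigma> j X = (\<chi> l. X $ sigma_tilde \<sigma> l j)"

definition gamma :: "('n::finite \<Rightarrow> 'N::finite \<Rightarrow> 'N) \<Rightarrow> ('v ^ 'n \<Rightarrow> 'v) \<Rightarrow> 'v ^ 'N \<Rightarrow> 'v ^ 'N"
  where "gamma \<sigma> f x = (\<chi> i. f (\<chi> j. x $ \<sigma> j i))"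

definition ker_gamma ::
    "('n::finite \<Rightarrow> 'N::finite \<Rightarrow> 'N) \<Rightarrow> ('v::real_normed_vector ^ 'n \<Rightarrow> 'v) set"
  where "ker_gamma \<sigma> = {h \<in> smooth_maps. gamma \<sigma> h = 0}"

definition partial_deriv ::
    "'n::finite \<Rightarrow> ('v::real_normed_vector ^ 'n \<Rightarrow> 'v) \<Rightarrow> 'v ^ 'n \<Rightarrow> 'v \<Rightarrow> 'v"
  where "partial_deriv j f X = frechet_derivative (\<lambda>v. f (\<chi> l. if l = j then v else X $ l)) (at (X $ j))"

definition ad ::
    "('n::finite \<Rightarrow> 'N::finite \<Rightarrow> 'N) \<Rightarrow> ('v::real_normed_vector ^ 'n \<Rightarrow> 'v) \<Rightarrow>
     ('v ^ 'n \<Rightarrow> 'v) \<Rightarrow> 'v ^ 'n \<Rightarrow> 'v"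
  where "ad \<sigma> f g = (\<lambda>X. \<Sum>j\<in>UNIV.
    partial_deriv j f X (g (A_map \<sigma> j X)) - partial_deriv j g X (f (A_map \<sigma> j X)))"

end

theory Submission
  imports Defs "HOL-Computational_Algebra.Polynomial_Factorial" "HOL-Computational_Algebra.Field_as_Ring"
begin

text \<open>
  The map \<open>\<gamma>\<close> turns the bracket on \<open>V^n\<close> into the Lie bracket with a linear vector field on
  \<open>V^N\<close>: for linear \<open>f\<close>, \<open>\<gamma> (ad f g) = [\<gamma> f, \<gamma> g]\<close> with \<open>[A, G] x = A (G x) - DG(x) (A x)\<close>
  (lemma \<open>gamma_ad\<close>). The quotient of \<open>P^k\<close> by the kernel of \<open>\<gamma>\<close> is therefore a space
  \<open>Y = \<gamma> ` P^k\<close> of homogeneous polynomial vector fields on which \<open>ad f0\<close>, \<open>ad f0S\<close> and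
  \<open>ad f0N\<close> act as the brackets with \<open>A = \<gamma> f0\<close>, \<open>A^S\<close> and \<open>A^N\<close>. Two facts finish the proof.

  First, \<open>[A, -] = [A^S, -] + [A^N, -]\<close> is an SN-decomposition on homogeneous polynomial maps
  (lemma \<open>SN_decomposition_linear_bracket\<close>), hence on the invariant subspace \<open>Y\<close>. Such a map is
  the restriction to the diagonal of a multilinear map, and the bracket with \<open>A\<close> lifts to
  \<open>M \<mapsto> A \<circ> M - (\<Sum>i. M (\<dots>, A x\<^sub>i, \<dots>))\<close>, a sum of commuting operators each of which
  satisfies, up to sign, every polynomial equation that \<open>A\<close> satisfies. So the question is why sums of commuting
  semisimple (nilpotent) operators are semisimple (nilpotent).

  Second, the SN-decomposition passes to quotients (lemma \<open>SN_decomposition_transfer\<close>): Newton's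
  iteration produces a polynomial \<open>s\<close> for which \<open>s(T)\<close> is the semisimple part of \<open>T\<close>, so anything
  that intertwines \<open>T\<close> with \<open>T'\<close> intertwines the semisimple parts.

  Semisimplicity over the reals is handled without eigenvalues. On a finite dimensional space \<open>S\<close> is
  semisimple iff \<open>p(S) = 0\<close> for some \<open>p\<close> that is coprime to its derivative. Given such \<open>p\<close>, a
  projection onto an invariant subspace can be averaged into one that commutes with \<open>S\<close>, and this can
  be repeated for the members of a commuting family (lemma \<open>projection_commuting_family\<close>). As a
  consequence an operator that is nilpotent and lies in the algebra generated by such a family
  vanishes (lemma \<open>nilpotent_eq_zero\<close>). This gives both the uniqueness of the SN-decomposition and
  the semisimplicity of sums of commuting semisimple operators.
\<close>

section \<open>Polynomials in an endomorphism\<close>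

lemma endomorphism_onI:
  assumes "\<And>x. x \<in> W \<Longrightarrow> T x \<in> W"
    and "\<And>x y. x \<in> W \<Longrightarrow> y \<in> W \<Longrightarrow> T (x + y) = T x + T y"
    and "\<And>c x. x \<in> W \<Longrightarrow> T (c *\<^sub>R x) = c *\<^sub>R T x"
  shows "endomorphism_on W T"
  using assms by (auto simp: endomorphism_on_def)

lemma endomorphism_onD:
  assumes "endomorphism_on W T"
  shows "x \<in> W \<Longrightarrow> T x \<in> W"
    and "x \<in> W \<Longrightarrow> y \<in> W \<Longrightarrow> T (x + y) = T x + T y"
    and "x \<in> W \<Longrightarrow> T (c *\<^sub>R x) = c *\<^sub>R T x"
  using assms by (auto simp: endomorphism_on_def)

lemma endomorphism_on_zero:
  assumes "subspace W" "endomorphism_on W T"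
  shows "T 0 = 0"
  using endomorphism_onD(3)[OF assms(2), of 0 0] subspace_0[OF assms(1)] by simp

lemma endomorphism_on_minus:
  assumes "endomorphism_on W T" "x \<in> W"
  shows "T (- x) = - T x"
  using endomorphism_onD(3)[OF assms, of "-1"] by simp

lemma endomorphism_on_diff:
  assumes "subspace W" "endomorphism_on W T" "x \<in> W" "y \<in> W"
  shows "T (x - y) = T x - T y"
  using endomorphism_onD(2)[OF assms(2,3) subspace_neg[OF assms(1,4)]]
    endomorphism_on_minus[OF assms(2,4)] by simp

lemma endomorphism_on_restrict:
  assumes "endomorphism_on W T" "U \<subseteq> W" "\<And>x. x \<in> U \<Longrightarrow> T x \<in> U"
  shows "endomorphism_on U T"
  using assms(2,3) endomorphism_onD[OF assms(1)] by (intro endomorphism_onI) blast+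

lemma endomorphism_on_cong:
  assumes "endomorphism_on W T" "subspace W" "\<And>x. x \<in> W \<Longrightarrow> S x = T x"
  shows "endomorphism_on W S"
  using assms by (intro endomorphism_onI) (auto simp: endomorphism_onD subspace_add subspace_scale)

lemma endomorphism_on_comp:
  assumes "endomorphism_on W S" "endomorphism_on W T"
  shows "endomorphism_on W (\<lambda>x. S (T x))"
  using assms by (intro endomorphism_onI) (auto simp: endomorphism_onD)

lemma endomorphism_on_add:
  assumes "subspace W" "endomorphism_on W S" "endomorphism_on W T"
  shows "endomorphism_on W (\<lambda>x. S x + T x)"
  using assms by (intro endomorphism_onI) (auto simp: endomorphism_onD subspace_add algebra_simps)

lemma endomorphism_on_uminus:
  assumes "subspace W" "endomorphism_on W T"
  shows "endomorphism_on W (\<lambda>x. - T x)"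
  using assms by (intro endomorphism_onI) (auto simp: endomorphism_onD subspace_neg)

lemma endomorphism_on_sub:
  assumes "subspace W" "endomorphism_on W S" "endomorphism_on W T"
  shows "endomorphism_on W (\<lambda>x. S x - T x)"
  using endomorphism_on_add[OF assms(1,2) endomorphism_on_uminus[OF assms(1,3)]] by simp

lemma endomorphism_on_funpow:
  assumes "endomorphism_on W T"
  shows "endomorphism_on W (T ^^ m)"
  by (induction m) (use assms in \<open>auto simp: endomorphism_on_def Pi_iff\<close>)

lemma endomorphism_on_sum:
  assumes "subspace W" "\<And>i. i \<in> I \<Longrightarrow> endomorphism_on W (T i)"
  shows "endomorphism_on W (\<lambda>x. \<Sum>i\<in>I. T i x)"
  using assms
  by (intro endomorphism_onI)
    (auto simp: endomorphism_onD[OF assms(2)] scaleR_sum_right sum.distrib[symmetric]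
      intro!: subspace_sum[OF assms(1)] sum.cong)

text \<open>
  The operator \<open>p(T)\<close>, evaluated by Horner's scheme.
\<close>

definition poly_op :: "real poly \<Rightarrow> ('a::real_vector \<Rightarrow> 'a) \<Rightarrow> 'a \<Rightarrow> 'a"
  where "poly_op p T x = foldr (\<lambda>a y. a *\<^sub>R x + T y) (coeffs p) 0"

lemma poly_op_0 [simp]: "poly_op 0 T x = 0"
  by (simp add: poly_op_def)

lemma poly_op_pCons:
  assumes "T 0 = 0"
  shows "poly_op (pCons a p) T x = a *\<^sub>R x + T (poly_op p T x)"
  using assms by (cases "p = 0 \<and> a = 0") (auto simp: poly_op_def cCons_def)

context
  fixes W :: "'a::real_vector set" and T :: "'a \<Rightarrow> 'a"
  assumes W: "subspace W" and T: "endomorphism_on W T"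
begin

lemma poly_op_in: "x \<in> W \<Longrightarrow> poly_op p T x \<in> W"
  by (induction p)
    (auto simp: poly_op_pCons endomorphism_on_zero[OF W T] endomorphism_onD(1)[OF T]
      subspace_0[OF W] intro!: subspace_add[OF W] subspace_scale[OF W])

lemma poly_op_const: "poly_op [:c:] T x = c *\<^sub>R x"
  by (simp add: poly_op_pCons endomorphism_on_zero[OF W T])

lemma poly_op_one: "poly_op 1 T x = x"
  by (simp add: one_pCons poly_op_const)

lemma poly_op_X: "poly_op [:0, 1:] T x = T x"
  by (simp add: poly_op_pCons endomorphism_on_zero[OF W T])

lemma poly_op_add: "x \<in> W \<Longrightarrow> poly_op (p + q) T x = poly_op p T x + poly_op q T x"
proof (induction p arbitrary: q)
  case (pCons a p)
  obtain b q' where q: "q = pCons b q'" by (rule pCons_cases)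
  show ?case
    using pCons.IH[OF pCons.prems, of q'] pCons.prems
    by (simp add: q poly_op_pCons endomorphism_on_zero[OF W T] endomorphism_onD(2)[OF T]
        poly_op_in algebra_simps)
qed simp

lemma poly_op_smult: "x \<in> W \<Longrightarrow> poly_op (smult c p) T x = c *\<^sub>R poly_op p T x"
  by (induction p)
    (auto simp: poly_op_pCons endomorphism_on_zero[OF W T] endomorphism_onD(3)[OF T]
      poly_op_in algebra_simps)

lemma poly_op_diff: "x \<in> W \<Longrightarrow> poly_op (p - q) T x = poly_op p T x - poly_op q T x"
  using poly_op_add[of x p "smult (-1) q"] poly_op_smult[of x "-1" q] by simp

lemma poly_op_mult: "x \<in> W \<Longrightarrow> poly_op (p * q) T x = poly_op p T (poly_op q T x)"
  by (induction p)
    (auto simp: poly_op_pCons endomorphism_on_zero[OF W T] poly_op_add poly_op_smult)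

lemma poly_op_power: "x \<in> W \<Longrightarrow> poly_op (p ^ m) T x = (poly_op p T ^^ m) x"
  by (induction m) (auto simp: poly_op_one poly_op_mult)

lemma poly_op_pcompose:
  assumes "x \<in> W" shows "poly_op (pcompose p q) T x = poly_op p (poly_op q T) x"
proof -
  have [simp]: "poly_op q T 0 = 0"
    by (induction q) (auto simp: poly_op_pCons endomorphism_on_zero[OF W T])
  show ?thesis
    using assms
    by (induction p) (auto simp: pcompose_pCons poly_op_pCons poly_op_add poly_op_mult poly_op_const)
qed

text \<open>
  All transport of annihilating polynomials and of semisimple parts rests on this: it is applied to
  \<open>\<gamma>\<close>, to the restriction of multilinear maps to the diagonal, and, with \<open>T' = T\<close>, to operators that
  commute with \<open>T\<close>.
\<close>

lemma poly_op_intertwine: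
  assumes "\<And>x y. x \<in> W \<Longrightarrow> y \<in> W \<Longrightarrow> \<Phi> (x + y) = \<Phi> x + \<Phi> y"
    and "\<And>c x. x \<in> W \<Longrightarrow> \<Phi> (c *\<^sub>R x) = c *\<^sub>R \<Phi> x"
    and "\<And>x. x \<in> W \<Longrightarrow> \<Phi> (T x) = T' (\<Phi> x)" and "x \<in> W"
  shows "\<Phi> (poly_op p T x) = poly_op p T' (\<Phi> x)"
proof -
  have \<Phi>0: "\<Phi> 0 = 0" using assms(2)[of 0 0] subspace_0[OF W] by simp
  then have T'0: "T' 0 = 0"
    using assms(3)[of 0] endomorphism_on_zero[OF W T] subspace_0[OF W] by simp
  show ?thesis
    using \<open>x \<in> W\<close>
    by (induction p)
      (auto simp: poly_op_pCons endomorphism_on_zero[OF W T] T'0 \<Phi>0 assms(1,2,3) poly_op_in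
        subspace_scale[OF W] endomorphism_onD(1)[OF T])
qed

lemma poly_op_commute:
  assumes "endomorphism_on W C" "\<And>x. x \<in> W \<Longrightarrow> C (T x) = T (C x)" "x \<in> W"
  shows "C (poly_op p T x) = poly_op p T (C x)"
  using assms by (intro poly_op_intertwine) (auto simp: endomorphism_onD)

lemma poly_op_commute_self: "x \<in> W \<Longrightarrow> poly_op p T (T x) = T (poly_op p T x)"
  using poly_op_commute[OF T] by simp

lemma endomorphism_on_poly_op: "endomorphism_on W (poly_op p T)"
proof (rule endomorphism_onI)
  show "poly_op p T (x + y) = poly_op p T x + poly_op p T y" if "x \<in> W" "y \<in> W" for x y
    using that
    by (induction p)
      (auto simp: poly_op_pCons endomorphism_on_zero[OF W T] endomorphism_onD(2)[OF T]
        poly_op_in subspace_add[OF W] algebra_simps)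
  show "poly_op p T (c *\<^sub>R x) = c *\<^sub>R poly_op p T x" if "x \<in> W" for c x
    using that
    by (induction p)
      (auto simp: poly_op_pCons endomorphism_on_zero[OF W T] endomorphism_onD(3)[OF T]
        poly_op_in subspace_scale[OF W] algebra_simps)
qed (rule poly_op_in)

end

lemma poly_op_monom:
  assumes "subspace W" "endomorphism_on W T" "x \<in> W"
  shows "poly_op (monom c i) T x = c *\<^sub>R (T ^^ i) x"
proof -
  have "poly_op (monom c i) T x = c *\<^sub>R (poly_op [:0, 1:] T ^^ i) x"
    by (simp add: monom_altdef poly_op_smult[OF assms] poly_op_power[OF assms])
  also have "poly_op [:0, 1:] T = T" by (rule ext) (rule poly_op_X[OF assms(1,2)])
  finally show ?thesis .
qed

lemma poly_op_sum:
  assumes "subspace W" "endomorphism_on W T" "x \<in> W"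
  shows "poly_op (\<Sum>i\<in>I. q i) T x = (\<Sum>i\<in>I. poly_op (q i) T x)"
  by (induction I rule: infinite_finite_induct) (auto simp: poly_op_add[OF assms])

lemma poly_op_intertwine_linear:
  assumes "subspace W" "endomorphism_on W T" "linear \<Phi>"
    and "\<And>x. x \<in> W \<Longrightarrow> \<Phi> (T x) = T' (\<Phi> x)" and "x \<in> W"
  shows "\<Phi> (poly_op p T x) = poly_op p T' (\<Phi> x)"
proof (rule poly_op_intertwine[where \<Phi> = \<Phi> and T' = T', OF assms(1,2)])
  show "\<Phi> (x + y) = \<Phi> x + \<Phi> y" for x y by (rule linear_add[OF assms(3)])
  show "\<Phi> (c *\<^sub>R x) = c *\<^sub>R \<Phi> x" for c x by (rule linear_scale[OF assms(3)])
qed (fact assms)+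

section \<open>Separable polynomials\<close>

text \<open>
  In characteristic zero these are the squarefree polynomials. The form with the derivative provides
  the inverse of \<open>p'\<close> modulo \<open>p\<close> that both the averaging of projections and Newton's iteration use.
\<close>

definition separable_poly :: "real poly \<Rightarrow> bool"
  where "separable_poly p \<longleftrightarrow> coprime p (pderiv p)"

lemma gcd_add_mult_right: "gcd a (b + c * a) = gcd a (b :: real poly)"
  by (metis add.commute gcd_add_mult)

lemma separable_poly_bezout:
  assumes "separable_poly p"
  obtains r t where "r * pderiv p + t * p = 1"
  using assms bezout_coefficients_fst_snd[of "pderiv p" p]
  by (metis coprime_imp_gcd_eq_1 gcd.commute separable_poly_def)

text \<open>
  Take the product of the distinct prime factors of \<open>m\<close>. Adding a new prime \<open>q\<close> to \<open>p\<close> preserves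
  separability because \<open>(q p)' = q' p + q p'\<close>, where \<open>q\<close> does not divide \<open>q'\<close> for reasons of degree.
\<close>

lemma dvd_power_separable_poly:
  fixes m :: "real poly"
  assumes "m \<noteq> 0"
  shows "\<exists>p e. separable_poly p \<and> m dvd p ^ e"
  using assms
proof (induction m rule: prime_divisors_induct)
  case (unit m)
  then have "separable_poly 1 \<and> m dvd 1 ^ 0"
    by (auto simp: separable_poly_def)
  then show ?case by blast
next
  case (factor q m)
  then obtain p e where p: "separable_poly p" "m dvd p ^ e" by auto
  show ?case
  proof (cases "q dvd p")
    case True
    then have "q * m dvd p ^ Suc e" using p(2) by (simp add: mult_dvd_mono)
    with p(1) show ?thesis by blast
  next
    case False
    have q: "prime_elem q" using factor.hyps by blast
    have "degree q \<noteq> 0"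
      using q by (metis is_unit_iff_degree not_prime_elem_zero prime_elem_not_unit)
    then have "coprime q (pderiv q)"
      using q by (simp add: prime_elem_imp_coprime)
    moreover have "coprime q p" using q False by (simp add: prime_elem_imp_coprime)
    ultimately have "coprime q (pderiv q * p)" "coprime p (q * pderiv p)"
      using p(1) by (auto simp: separable_poly_def coprime_commute)
    then have "coprime q (pderiv q * p + pderiv p * q)" "coprime p (q * pderiv p + pderiv q * p)"
      by (simp_all only: coprime_iff_gcd_eq_1 gcd_add_mult_right)
    then have "coprime q (pderiv (q * p))" "coprime p (pderiv (q * p))"
      by (simp_all add: pderiv_mult algebra_simps)
    then have "separable_poly (q * p)"
      unfolding separable_poly_def by simp
    moreover have "q * m dvd (q * p) ^ Suc e"
      using dvd_mult_left[of m "q ^ e"] p(2)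
      by (simp add: power_mult_distrib mult_ac)
    ultimately show ?thesis by blast
  qed
qed auto

lemma pcompose_taylor:
  fixes p s h :: "real poly"
  shows "\<exists>r. pcompose p (s + h) = pcompose p s + h * pcompose (pderiv p) s + h ^ 2 * r"
proof (induction p)
  case (pCons a p)
  then obtain r where r: "pcompose p (s + h) = pcompose p s + h * pcompose (pderiv p) s + h ^ 2 * r"
    by blast
  have "pcompose (pCons a p) (s + h) = pcompose (pCons a p) s + h * pcompose (pderiv (pCons a p)) s
      + h ^ 2 * (pcompose (pderiv p) s + (s + h) * r)"
    unfolding pcompose_pCons pderiv_pCons pcompose_add r
    by (simp add: algebra_simps power2_eq_square)
  then show ?case by blast
qed simp

lemma dvd_pcompose_diff:
  fixes p s t :: "real poly"
  shows "s - t dvd pcompose p s - pcompose p t"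
proof (induction p)
  case (pCons a p)
  have "pcompose (pCons a p) s - pcompose (pCons a p) t
      = s * (pcompose p s - pcompose p t) + (s - t) * pcompose p t"
    by (simp add: pcompose_pCons algebra_simps)
  with pCons show ?case by simp
qed simp

text \<open>
  Newton's iteration for the equation \<open>p(s) = 0\<close> modulo powers of \<open>p\<close>, started at the solution
  \<open>s = x\<close> modulo \<open>p\<close>. Inserting an operator \<open>T\<close> with \<open>p(T)^(e+1) = 0\<close> gives \<open>p(s(T)) = 0\<close>, while
  \<open>T - s(T)\<close> is nilpotent as a multiple of \<open>p(T)\<close>.
\<close>

lemma separable_poly_newton:
  assumes "separable_poly p"
  shows "\<exists>s. p ^ Suc e dvd pcompose p s \<and> p dvd s - [:0, 1:]"
proof (induction e)
  case 0
  show ?case by (rule exI[of _ "[:0, 1:]"]) (simp add: pcompose_idR)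
next
  case (Suc e)
  then obtain s where s: "p ^ Suc e dvd pcompose p s" "p dvd s - [:0, 1:]" by blast
  obtain r t where rt: "r * pderiv p + t * p = 1" using separable_poly_bezout[OF assms] .
  \<comment> \<open>Newton's correction: \<open>r\<close> inverts \<open>p'\<close> modulo \<open>p\<close>, hence also \<open>p'(s)\<close>\<close>
  define h where "h = - (r * pcompose p s)"
  obtain w where w: "pcompose p (s + h) = pcompose p s + h * pcompose (pderiv p) s + h ^ 2 * w"
    using pcompose_taylor by blast
  have "p dvd pcompose (pderiv p) s - pderiv p"
    using dvd_trans[OF s(2) dvd_pcompose_diff[of s "[:0, 1:]" "pderiv p"]] by (simp add: pcompose_idR)
  moreover have "1 - r * pcompose (pderiv p) s
      = t * p - r * (pcompose (pderiv p) s - pderiv p)"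
    using rt by (simp add: algebra_simps flip: rt)
  ultimately have "p dvd 1 - r * pcompose (pderiv p) s" by simp
  then have 1: "p ^ Suc e * p dvd pcompose p s * (1 - r * pcompose (pderiv p) s)"
    using s(1) mult_dvd_mono by blast
  have "p dvd pcompose p s" using s(1) by (metis dvd_mult_left power_Suc)
  then have 2: "p ^ Suc e * p dvd h ^ 2 * w"
  proof -
    have "h ^ 2 * w = (pcompose p s * pcompose p s) * (r * r * w)"
      by (simp add: h_def power2_eq_square algebra_simps)
    then show ?thesis
      using mult_dvd_mono[OF s(1) \<open>p dvd pcompose p s\<close>] by (metis dvd_mult2)
  qed
  have "pcompose p (s + h) = pcompose p s * (1 - r * pcompose (pderiv p) s) + h ^ 2 * w"
    unfolding w by (simp add: h_def algebra_simps)
  then have "p ^ Suc (Suc e) dvd pcompose p (s + h)"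
    using 1 2 by (simp add: mult.commute)
  moreover have "p dvd s + h - [:0, 1:]"
  proof -
    have "s + h - [:0, 1:] = (s - [:0, 1:]) + h" by simp
    moreover have "p dvd h" using \<open>p dvd pcompose p s\<close> by (simp add: h_def)
    ultimately show ?thesis using s(2) by (simp only: dvd_add)
  qed
  ultimately show ?case by blast
qed

section \<open>Commuting families of separable operators\<close>

text \<open>
  On finite dimensional spaces this is the notion of a semisimple operator, in a form that is
  inherited by invariant subspaces and by images under intertwining maps.
\<close>

definition separable_on :: "'a::real_vector set \<Rightarrow> ('a \<Rightarrow> 'a) \<Rightarrow> bool"
  where "separable_on W S \<longleftrightarrow>
    endomorphism_on W S \<and> (\<exists>p. separable_poly p \<and> (\<forall>x\<in>W. poly_op p S x = 0))"

definition commute_on :: "'a set \<Rightarrow> ('a \<Rightarrow> 'a) \<Rightarrow> ('a \<Rightarrow> 'a) \<Rightarrow> bool"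
  where "commute_on W S T \<longleftrightarrow> (\<forall>x\<in>W. S (T x) = T (S x))"

lemma commute_onD: "commute_on W S T \<Longrightarrow> x \<in> W \<Longrightarrow> S (T x) = T (S x)"
  by (simp add: commute_on_def)

lemma commute_on_sym: "commute_on W S T \<longleftrightarrow> commute_on W T S"
  by (auto simp: commute_on_def)

definition projection_onto :: "'a::real_vector set \<Rightarrow> 'a set \<Rightarrow> ('a \<Rightarrow> 'a) \<Rightarrow> bool"
  where "projection_onto W U \<pi> \<longleftrightarrow>
    endomorphism_on W \<pi> \<and> \<pi> ` W \<subseteq> U \<and> (\<forall>u\<in>U. \<pi> u = u)"

lemma projection_onto_exists:
  assumes "subspace (U :: 'a::real_vector set)" "U \<subseteq> W"
  shows "\<exists>\<pi>. projection_onto W U \<pi>"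
proof -
  obtain g :: "'a \<Rightarrow> 'a" where g: "g ` UNIV \<subseteq> U" "linear g" "\<forall>v\<in>U. g v = v"
    using linear_exists_left_inverse_on[OF linear_id assms(1)] by (auto simp: id_def)
  then have "projection_onto W U g"
    using assms(2) by (auto simp: projection_onto_def linear_add linear_scale intro!: endomorphism_onI)
  then show ?thesis by blast
qed

text \<open>
  For \<open>p = x^m\<close> the operator is \<open>\<alpha> = (\<Sum>i<m. S^i \<pi> S^(m-1-i))\<close>: its commutator with \<open>S\<close> telescopes to
  \<open>S^m \<pi> - \<pi> S^m\<close>, and where \<open>\<pi>\<close> is the identity it equals \<open>m S^(m-1)\<close>. Since the construction is
  linear in \<open>p\<close>, the general case follows, here by recursion along Horner's scheme. The set \<open>F\<close> records
  what the construction preserves.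
\<close>

lemma averaging:
  assumes W: "subspace W" and S: "endomorphism_on W S"
    and U: "subspace U" "U \<subseteq> W" "S ` U \<subseteq> U"
    and \<pi>: "projection_onto W U \<pi>"
    and F: "\<And>C. C \<in> F \<Longrightarrow> endomorphism_on W C"
      "\<And>C. C \<in> F \<Longrightarrow> commute_on W C S" "\<And>C. C \<in> F \<Longrightarrow> commute_on W C \<pi>"
  shows "\<exists>\<alpha>. endomorphism_on W \<alpha> \<and> \<alpha> ` W \<subseteq> U \<and>
    (\<forall>x\<in>W. S (\<alpha> x) - \<alpha> (S x) = poly_op p S (\<pi> x) - \<pi> (poly_op p S x)) \<and>
    (\<forall>u\<in>U. \<alpha> u = poly_op (pderiv p) S u) \<and> (\<forall>C\<in>F. commute_on W C \<alpha>)"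
proof (induction p)
  case 0
  have "\<pi> 0 = 0" using endomorphism_on_zero[OF W] \<pi> by (auto simp: projection_onto_def)
  then show ?case
    using F(1) endomorphism_on_zero[OF W] S subspace_0[OF W] subspace_0[OF U(1)]
    by (intro exI[of _ "\<lambda>x. 0"]) (auto simp: commute_on_def intro!: endomorphism_onI)
next
  case (pCons a q)
  then obtain \<alpha> where \<alpha>: "endomorphism_on W \<alpha>" "\<alpha> ` W \<subseteq> U"
    "\<And>x. x \<in> W \<Longrightarrow> S (\<alpha> x) - \<alpha> (S x) = poly_op q S (\<pi> x) - \<pi> (poly_op q S x)"
    "\<And>u. u \<in> U \<Longrightarrow> \<alpha> u = poly_op (pderiv q) S u" "\<And>C. C \<in> F \<Longrightarrow> commute_on W C \<alpha>"
    by blast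
  \<comment> \<open>\<open>x q(x)\<close> contributes \<open>q(S) \<pi>\<close> in addition to \<open>\<alpha>\<close> for \<open>q\<close> composed with \<open>S\<close>\<close>
  let ?\<beta> = "\<lambda>x. poly_op q S (\<pi> x) + \<alpha> (S x)"
  have SU: "endomorphism_on U S"
    using endomorphism_on_restrict[OF S U(2)] U(3) by blast
  have \<pi>e: "endomorphism_on W \<pi>" and \<pi>U: "\<And>x. x \<in> W \<Longrightarrow> \<pi> x \<in> U" and \<pi>id: "\<And>u. u \<in> U \<Longrightarrow> \<pi> u = u"
    using \<pi> by (auto simp: projection_onto_def)
  have S0: "S 0 = 0" by (rule endomorphism_on_zero[OF W S])
  have e: "endomorphism_on W ?\<beta>"
    by (rule endomorphism_on_add[OF W endomorphism_on_comp[OF endomorphism_on_poly_op[OF W S] \<pi>e]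
          endomorphism_on_comp[OF \<alpha>(1) S]])
  have in_U: "?\<beta> x \<in> U" if "x \<in> W" for x
  proof (rule subspace_add[OF U(1)])
    show "poly_op q S (\<pi> x) \<in> U" by (rule poly_op_in[OF U(1) SU \<pi>U[OF that]])
    show "\<alpha> (S x) \<in> U" using \<alpha>(2) endomorphism_onD(1)[OF S that] by blast
  qed
  have comm: "S (?\<beta> x) - ?\<beta> (S x) = poly_op (pCons a q) S (\<pi> x) - \<pi> (poly_op (pCons a q) S x)"
    if x: "x \<in> W" for x
  proof -
    have Sx: "S x \<in> W" and \<pi>x: "\<pi> x \<in> W" and qx: "poly_op q S (\<pi> x) \<in> W" "poly_op q S x \<in> W"
      using endomorphism_onD(1)[OF S x] endomorphism_onD(1)[OF \<pi>e x] poly_op_in[OF W S] x by auto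
    have "S (?\<beta> x) - ?\<beta> (S x)
        = S (poly_op q S (\<pi> x)) - poly_op q S (\<pi> (S x)) + (S (\<alpha> (S x)) - \<alpha> (S (S x)))"
      using endomorphism_onD(2)[OF S qx(1) endomorphism_onD(1)[OF \<alpha>(1) Sx]] by simp
    also have "\<dots> = S (poly_op q S (\<pi> x)) - \<pi> (S (poly_op q S x))"
      by (simp add: \<alpha>(3)[OF Sx] poly_op_commute_self[OF W S x])
    also have "\<dots> = poly_op (pCons a q) S (\<pi> x) - \<pi> (poly_op (pCons a q) S x)"
      using x qx endomorphism_onD(1)[OF S qx(2)]
      by (simp add: poly_op_pCons[where T = S, OF S0] endomorphism_onD[OF \<pi>e] subspace_scale[OF W])
    finally show ?thesis .
  qed
  have der: "?\<beta> u = poly_op (pderiv (pCons a q)) S u" if u: "u \<in> U" for u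
  proof -
    have "S u \<in> U" "u \<in> W" using u U by auto
    then show ?thesis
      using u
      by (simp add: \<pi>id \<alpha>(4) pderiv_pCons poly_op_add[OF W S] poly_op_pCons[where T = S, OF S0]
          poly_op_commute_self[OF W S])
  qed
  have comm_F: "commute_on W C ?\<beta>" if C: "C \<in> F" for C
    unfolding commute_on_def
  proof
    fix x assume x: "x \<in> W"
    have Sx: "S x \<in> W" and \<pi>x: "\<pi> x \<in> W" and qx: "poly_op q S (\<pi> x) \<in> W"
      using endomorphism_onD(1)[OF S x] endomorphism_onD(1)[OF \<pi>e x] poly_op_in[OF W S] x by auto
    have "C (?\<beta> x) = C (poly_op q S (\<pi> x)) + C (\<alpha> (S x))"
      using endomorphism_onD(2)[OF F(1)[OF C] qx endomorphism_onD(1)[OF \<alpha>(1) Sx]] .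
    also have "C (poly_op q S (\<pi> x)) = poly_op q S (\<pi> (C x))"
      using poly_op_commute[OF W S F(1)[OF C] commute_onD[OF F(2)[OF C]] \<pi>x]
        commute_onD[OF F(3)[OF C] x] by simp
    also have "C (\<alpha> (S x)) = \<alpha> (S (C x))"
      using commute_onD[OF \<alpha>(5)[OF C] Sx] commute_onD[OF F(2)[OF C] x] by simp
    finally show "C (?\<beta> x) = ?\<beta> (C x)" .
  qed
  show ?case
    by (intro exI[of _ ?\<beta>] conjI ballI image_subsetI e in_U comm der comm_F)
qed

text \<open>
  If \<open>p(S) = 0\<close>, the operator \<open>\<alpha>\<close> of the previous lemma commutes with \<open>S\<close> and equals \<open>p'(S)\<close> on \<open>U\<close>.
  With \<open>r p' = 1\<close> modulo \<open>p\<close>, the operator \<open>\<alpha> r(S)\<close> is a projection onto \<open>U\<close> that commutes with \<open>S\<close>.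
  This is Maschke's averaging with the order of the group replaced by \<open>p'(S)\<close>.
\<close>

lemma projection_commuting_step:
  assumes W: "subspace W" and S: "separable_on W S"
    and U: "subspace U" "U \<subseteq> W" "S ` U \<subseteq> U"
    and \<pi>: "projection_onto W U \<pi>"
    and F: "\<And>C. C \<in> F \<Longrightarrow> endomorphism_on W C"
      "\<And>C. C \<in> F \<Longrightarrow> commute_on W C S" "\<And>C. C \<in> F \<Longrightarrow> commute_on W C \<pi>"
  shows "\<exists>\<pi>'. projection_onto W U \<pi>' \<and> commute_on W S \<pi>' \<and> (\<forall>C\<in>F. commute_on W C \<pi>')"
proof -
  have Se: "endomorphism_on W S" using S by (simp add: separable_on_def)
  obtain p where p: "separable_poly p" "\<And>x. x \<in> W \<Longrightarrow> poly_op p S x = 0"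
    using S by (auto simp: separable_on_def)
  obtain r t where rt: "r * pderiv p + t * p = 1" using separable_poly_bezout[OF p(1)] .
  obtain \<alpha> where \<alpha>: "endomorphism_on W \<alpha>" "\<alpha> ` W \<subseteq> U"
    "\<And>x. x \<in> W \<Longrightarrow> S (\<alpha> x) - \<alpha> (S x) = poly_op p S (\<pi> x) - \<pi> (poly_op p S x)"
    "\<And>u. u \<in> U \<Longrightarrow> \<alpha> u = poly_op (pderiv p) S u" "\<And>C. C \<in> F \<Longrightarrow> commute_on W C \<alpha>"
    using averaging[OF W Se U \<pi> F, of F p] by blast
  have SU: "endomorphism_on U S"
    using endomorphism_on_restrict[OF Se U(2)] U(3) by blast
  have \<pi>e: "endomorphism_on W \<pi>" using \<pi> by (auto simp: projection_onto_def)
  have S\<alpha>: "S (\<alpha> x) = \<alpha> (S x)" if "x \<in> W" for x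
    using \<alpha>(3)[OF that] p(2) that endomorphism_onD(1)[OF \<pi>e that] endomorphism_on_zero[OF W \<pi>e]
    by simp
  let ?\<pi> = "\<lambda>x. \<alpha> (poly_op r S x)"
  have "?\<pi> u = u" if u: "u \<in> U" for u
  proof -
    have uW: "u \<in> W" using u U by auto
    have "?\<pi> u = poly_op (pderiv p * r) S u"
      using \<alpha>(4)[OF poly_op_in[OF U(1) SU u]] poly_op_mult[OF W Se uW] by simp
    also have "\<dots> = poly_op 1 S u - poly_op (t * p) S u"
      using rt poly_op_diff[OF W Se uW, of 1 "t * p"] by (simp add: algebra_simps flip: rt)
    also have "poly_op (t * p) S u = poly_op t S 0"
      using poly_op_mult[OF W Se uW] p(2)[OF uW] by simp
    also have "\<dots> = 0" by (rule endomorphism_on_zero[OF W endomorphism_on_poly_op[OF W Se]])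
    finally show ?thesis using poly_op_one[OF W Se] by simp
  qed
  then have "projection_onto W U ?\<pi>"
    using endomorphism_on_comp[OF \<alpha>(1) endomorphism_on_poly_op[OF W Se]] \<alpha>(2) poly_op_in[OF W Se]
    by (auto simp: projection_onto_def)
  moreover have "commute_on W S ?\<pi>"
    using S\<alpha> poly_op_in[OF W Se] poly_op_commute_self[OF W Se] by (simp add: commute_on_def)
  moreover have "commute_on W C ?\<pi>" if C: "C \<in> F" for C
    using commute_onD[OF \<alpha>(5)[OF C]] poly_op_in[OF W Se]
      poly_op_commute[OF W Se F(1)[OF C] commute_onD[OF F(2)[OF C]]] by (simp add: commute_on_def)
  ultimately show ?thesis by blast
qed

text \<open>
  Average over one operator after the other; since the operators commute, a later step does not
  destroy the commutation obtained in an earlier one.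
\<close>

lemma projection_commuting_family:
  assumes W: "subspace W" and "finite F"
    and F: "\<And>S. S \<in> F \<Longrightarrow> separable_on W S"
      "\<And>S T. S \<in> F \<Longrightarrow> T \<in> F \<Longrightarrow> commute_on W S T"
    and U: "subspace U" "U \<subseteq> W" "\<And>S. S \<in> F \<Longrightarrow> S ` U \<subseteq> U"
  shows "\<exists>\<pi>. projection_onto W U \<pi> \<and> (\<forall>S\<in>F. commute_on W S \<pi>)"
  using \<open>finite F\<close> F U(3)
proof (induction F)
  case empty
  then show ?case using projection_onto_exists[OF U(1,2)] by blast
next
  case (insert S F)
  have "\<exists>\<pi>. projection_onto W U \<pi> \<and> (\<forall>C\<in>F. commute_on W C \<pi>)"
    by (rule insert.IH) (simp_all add: insert.prems)
  then obtain \<pi> where \<pi>: "projection_onto W U \<pi>" "\<And>C. C \<in> F \<Longrightarrow> commute_on W C \<pi>" by blast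
  have "\<exists>\<pi>'. projection_onto W U \<pi>' \<and> commute_on W S \<pi>' \<and> (\<forall>C\<in>F. commute_on W C \<pi>')"
  proof (rule projection_commuting_step[OF W _ U(1,2) _ \<pi>(1)])
    show "endomorphism_on W C" if "C \<in> F" for C
      using insert.prems(1)[of C] that by (simp add: separable_on_def)
  qed (simp_all add: insert.prems \<pi>(2))
  then show ?case by simp
qed

text \<open>
  The kernel of \<open>E\<close> is invariant under \<open>F\<close>, so it has a projection \<open>\<pi>\<close> that commutes with \<open>F\<close> and
  therefore with \<open>E\<close>. On the kernel of \<open>\<pi>\<close> the operator \<open>E\<close> is injective and nilpotent, so this
  complement is zero. The hypothesis \<open>gen\<close> says that \<open>E\<close> lies in the bicommutant of \<open>F\<close>; it is
  satisfied by polynomials in the members of \<open>F\<close>.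
\<close>

lemma nilpotent_eq_zero:
  assumes W: "subspace W" and "finite F"
    and F: "\<And>S. S \<in> F \<Longrightarrow> separable_on W S"
      "\<And>S T. S \<in> F \<Longrightarrow> T \<in> F \<Longrightarrow> commute_on W S T"
    and E: "endomorphism_on W E" "nilpotent_on W E" "\<And>S. S \<in> F \<Longrightarrow> commute_on W S E"
    and gen: "\<And>\<pi>. endomorphism_on W \<pi> \<Longrightarrow> (\<And>S. S \<in> F \<Longrightarrow> commute_on W S \<pi>) \<Longrightarrow> commute_on W E \<pi>"
    and x: "x \<in> W"
  shows "E x = 0"
proof -
  let ?U = "{x\<in>W. E x = 0}"
  have U: "subspace ?U"
    using endomorphism_on_zero[OF W E(1)]
    by (auto simp: subspace_def subspace_0[OF W] subspace_add[OF W] subspace_scale[OF W]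
        endomorphism_onD[OF E(1)])
  have "S ` ?U \<subseteq> ?U" if "S \<in> F" for S
  proof -
    have Se: "endomorphism_on W S" using F(1)[OF that] by (simp add: separable_on_def)
    show ?thesis
      using endomorphism_on_zero[OF W Se] endomorphism_onD(1)[OF Se]
      by (auto simp flip: commute_onD[OF E(3)[OF that]])
  qed
  then obtain \<pi> where \<pi>: "projection_onto W ?U \<pi>" "\<And>S. S \<in> F \<Longrightarrow> commute_on W S \<pi>"
    using projection_commuting_family[OF W \<open>finite F\<close> F U] by blast
  have \<pi>e: "endomorphism_on W \<pi>" and \<pi>W: "\<And>y. y \<in> W \<Longrightarrow> \<pi> y \<in> ?U" and \<pi>id: "\<And>u. u \<in> ?U \<Longrightarrow> \<pi> u = u"
    using \<pi>(1) by (auto simp: projection_onto_def)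
  have E\<pi>: "E (\<pi> y) = \<pi> (E y)" if "y \<in> W" for y
    using commute_onD[OF gen[OF \<pi>e \<pi>(2)] that] by blast
  \<comment> \<open>the component of \<open>x\<close> in the complement of the kernel of \<open>E\<close>\<close>
  define y where "y = x - \<pi> x"
  have px: "\<pi> x \<in> W" using \<pi>W[OF x] by simp
  have y: "y \<in> W" "\<pi> y = 0"
    using x px \<pi>id[OF \<pi>W[OF x]]
    by (auto simp: y_def subspace_diff[OF W] endomorphism_on_diff[OF W \<pi>e])
  have inj: "z = 0" if "z \<in> W" "\<pi> z = 0" "(E ^^ m) z = 0" for m z
    using that
  proof (induction m arbitrary: z)
    case (Suc m)
    have "E z = 0"
    proof (rule Suc.IH)
      show "E z \<in> W" using Suc.prems(1) endomorphism_onD(1)[OF E(1)] by blast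
      show "\<pi> (E z) = 0" using E\<pi>[OF Suc.prems(1)] Suc.prems(2) endomorphism_on_zero[OF W E(1)] by simp
      show "(E ^^ m) (E z) = 0" using Suc.prems(3) by (simp add: funpow_swap1)
    qed
    then show ?case using \<pi>id[of z] Suc.prems by simp
  qed simp
  obtain m where "\<forall>x\<in>W. (E ^^ m) x = 0" using E(2) by (auto simp: nilpotent_on_def)
  then have "y = 0" using inj y by blast
  then show ?thesis using \<pi>W[OF x] by (simp add: y_def)
qed

section \<open>Nilpotent operators\<close>

lemma funpow_zero:
  assumes "subspace W" "endomorphism_on W S"
  shows "(S ^^ m) 0 = 0"
  by (induction m) (auto simp: endomorphism_on_zero[OF assms])

text \<open>
  If \<open>S^a x = 0\<close> and \<open>T^b x = 0\<close> then \<open>(S + T)^(a+b) x = 0\<close>, by induction on \<open>a + b\<close>: the vector \<open>S x\<close>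
  satisfies the assumption with \<open>a - 1\<close> and \<open>T x\<close> satisfies it with \<open>b - 1\<close>.
\<close>

lemma nilpotent_on_add:
  assumes W: "subspace W" and S: "endomorphism_on W S" and T: "endomorphism_on W T"
    and comm: "commute_on W S T" and nil: "nilpotent_on W S" "nilpotent_on W T"
  shows "nilpotent_on W (\<lambda>x. S x + T x)"
proof -
  let ?E = "\<lambda>x. S x + T x"
  have E: "endomorphism_on W ?E" by (rule endomorphism_on_add[OF W S T])
  have pow_comm: "(T ^^ k) (S x) = S ((T ^^ k) x)" "(S ^^ k) (T x) = T ((S ^^ k) x)" if "x \<in> W" for k x
    using that endomorphism_onD(1)[OF endomorphism_on_funpow[OF T]]
      endomorphism_onD(1)[OF endomorphism_on_funpow[OF S]]
    by (induction k) (auto simp: commute_onD[OF comm])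
  have *: "(?E ^^ (a + b)) x = 0" if "x \<in> W" "(S ^^ a) x = 0" "(T ^^ b) x = 0" for a b x
    using that
  proof (induction "a + b" arbitrary: a b x)
    case 0
    then show ?case by simp
  next
    case (Suc n)
    show ?case
    proof (cases "a = 0 \<or> b = 0")
      case True
      then have "x = 0" using Suc.prems by auto
      then show ?thesis using funpow_zero[OF W E] by simp
    next
      case False
      then obtain a' b' where ab: "a = Suc a'" "b = Suc b'" by (metis not0_implies_Suc)
      have xW: "S x \<in> W" "T x \<in> W"
        using Suc.prems(1) endomorphism_onD(1)[OF S] endomorphism_onD(1)[OF T] by auto
      have Sx: "(S ^^ a') (S x) = 0" "(T ^^ b) (S x) = 0" and Tx: "(S ^^ a) (T x) = 0" "(T ^^ b') (T x) = 0"
        using Suc.prems ab endomorphism_on_zero[OF W S] endomorphism_on_zero[OF W T]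
          pow_comm(1)[of x b] pow_comm(2)[of x a] by (auto simp: funpow_Suc_right simp del: funpow.simps)
      have "(?E ^^ (a' + b)) (S x) = 0"
        using Suc.hyps(2) ab by (intro Suc.hyps(1) xW Sx) simp
      moreover have "(?E ^^ (a + b')) (T x) = 0"
        using Suc.hyps(2) ab by (intro Suc.hyps(1) xW Tx) simp
      moreover have "a' + b = n" "a + b' = n" using Suc.hyps(2) ab by auto
      ultimately have "(?E ^^ n) (?E x) = 0"
        using endomorphism_onD(2)[OF endomorphism_on_funpow[OF E] xW, of n] by simp
      then show ?thesis by (simp add: funpow_Suc_right del: funpow.simps flip: Suc.hyps(2))
    qed
  qed
  obtain a b where "\<forall>x\<in>W. (S ^^ a) x = 0" "\<forall>x\<in>W. (T ^^ b) x = 0"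
    using nil by (auto simp: nilpotent_on_def)
  then have "\<forall>x\<in>W. (?E ^^ (a + b)) x = 0" using * by blast
  then show ?thesis unfolding nilpotent_on_def by blast
qed

lemma nilpotent_on_uminus:
  assumes T: "endomorphism_on W T" and "nilpotent_on W T"
  shows "nilpotent_on W (\<lambda>x. - T x)"
proof -
  obtain m where m: "\<forall>x\<in>W. (T ^^ m) x = 0" using assms(2) by (auto simp: nilpotent_on_def)
  have "((\<lambda>x. - T x) ^^ k) x = (- 1) ^ k *\<^sub>R (T ^^ k) x" if "x \<in> W" for k x
    using that
    by (induction k) (auto simp: endomorphism_onD[OF T] endomorphism_onD(1)[OF endomorphism_on_funpow[OF T]])
  then show ?thesis using m unfolding nilpotent_on_def by (metis scaleR_zero_right)
qed

lemma nilpotent_on_sum: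
  assumes W: "subspace W" and "finite I"
    and T: "\<And>i. i \<in> I \<Longrightarrow> endomorphism_on W (T i)"
    and "\<And>i j. i \<in> I \<Longrightarrow> j \<in> I \<Longrightarrow> commute_on W (T i) (T j)"
    and "\<And>i. i \<in> I \<Longrightarrow> nilpotent_on W (T i)"
  shows "nilpotent_on W (\<lambda>x. \<Sum>i\<in>I. T i x)"
  using assms(2-)
proof (induction I)
  case empty
  have "\<forall>x\<in>W. ((\<lambda>x. \<Sum>i\<in>{}. T i x) ^^ 1) x = 0" by simp
  then show ?case unfolding nilpotent_on_def by blast
next
  case (insert j I)
  have e: "endomorphism_on W (\<lambda>x. \<Sum>i\<in>I. T i x)" "endomorphism_on W (T j)"
    by (auto intro!: endomorphism_on_sum[OF W] insert.prems)
  have "T j (\<Sum>i\<in>I. T i x) = (\<Sum>i\<in>I. T j (T i x))" if "x \<in> W" for x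
    using insert.hyps(1) insert.prems(1) that
  proof (induction I)
    case (insert i I)
    then have "(\<Sum>i\<in>I. T i x) \<in> W" "T i x \<in> W"
      by (auto intro!: subspace_sum[OF W] simp: endomorphism_onD(1))
    moreover have "T j (\<Sum>i\<in>I. T i x) = (\<Sum>i\<in>I. T j (T i x))"
      by (rule insert.IH) (use insert.prems in auto)
    ultimately show ?case using insert.hyps by (simp add: endomorphism_onD(2)[OF e(2)])
  qed (simp add: endomorphism_on_zero[OF W e(2)])
  then have "commute_on W (T j) (\<lambda>x. \<Sum>i\<in>I. T i x)"
    using insert.prems(2) by (auto simp: commute_on_def intro!: sum.cong)
  then have "nilpotent_on W (\<lambda>x. T j x + (\<Sum>i\<in>I. T i x))"
    using nilpotent_on_add[OF W e(2,1)] insert by auto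
  then show ?case using insert.hyps by simp
qed

lemma funpow_cong_on:
  assumes T: "endomorphism_on W T" and ST: "\<And>x. x \<in> W \<Longrightarrow> S x = T x" and x: "x \<in> W"
  shows "(S ^^ k) x = (T ^^ k) x"
proof (induction k)
  case (Suc k)
  have "(T ^^ k) x \<in> W" by (rule endomorphism_onD(1)[OF endomorphism_on_funpow[OF T] x])
  then show ?case using Suc ST by simp
qed simp

lemma nilpotent_on_cong:
  assumes "endomorphism_on W T" "nilpotent_on W T" "\<And>x. x \<in> W \<Longrightarrow> S x = T x"
  shows "nilpotent_on W S"
  using assms(2) funpow_cong_on[OF assms(1,3)] unfolding nilpotent_on_def by simp

section \<open>Semisimple operators\<close>

text \<open>
  Finite dimension of a subspace of a possibly infinite dimensional space of maps.
\<close>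

definition finitely_spanned :: "'a::real_vector set \<Rightarrow> bool"
  where "finitely_spanned W \<longleftrightarrow> (\<exists>B. finite B \<and> W \<subseteq> span B)"

lemma finitely_spanned_basis:
  fixes W :: "'a::real_vector set"
  assumes "subspace W" "finitely_spanned W"
  obtains B where "finite B" "B \<subseteq> W" "span B = W"
proof -
  obtain C where C: "finite C" "W \<subseteq> span C" using assms(2) by (auto simp: finitely_spanned_def)
  obtain B where B: "B \<subseteq> W" "independent B" "W \<subseteq> span B"
    using maximal_independent_subset[of W] by blast
  have "finite B" using independent_span_bound[OF C(1) B(2)] B(1) C(2) by blast
  moreover have "span B = W" using B(1,3) span_subspace[OF B(1,3) assms(1)] by blast
  ultimately show ?thesis using that B(1) by blast
qed

lemma finitely_spanned_linear_image:
  assumes "finitely_spanned W" "linear f"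
  shows "finitely_spanned (f ` W)"
proof -
  obtain C where C: "finite C" "W \<subseteq> span C" using assms(1) by (auto simp: finitely_spanned_def)
  then have "f ` W \<subseteq> span (f ` C)" using linear_span_image[OF assms(2), of C] by blast
  then show ?thesis using C(1) unfolding finitely_spanned_def by blast
qed

text \<open>
  Otherwise the iterates \<open>T^i x\<close> would be infinitely many independent vectors.
\<close>

lemma vector_annihilator_exists:
  fixes W :: "'a::real_vector set"
  assumes W: "subspace W" "finitely_spanned W" and T: "endomorphism_on W T" and x: "x \<in> W"
  shows "\<exists>q. q \<noteq> 0 \<and> poly_op q T x = 0"
proof (rule ccontr)
  assume "\<not> ?thesis"
  then have nz: "\<And>q. q \<noteq> 0 \<Longrightarrow> poly_op q T x \<noteq> 0" by blast
  define v where "v i = (T ^^ i) x" for i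
  have "inj v"
  proof (rule injI, rule ccontr)
    fix i j assume ij: "v i = v j" "i \<noteq> j"
    have "monom 1 i - monom 1 j \<noteq> (0 :: real poly)" using ij(2) by (simp add: monom_eq_iff')
    from nz[OF this] show False
      using ij(1) by (simp add: poly_op_diff[OF W(1) T x] poly_op_monom[OF W(1) T x] v_def)
  qed
  have "independent (range v)"
    unfolding dependent_explicit
  proof safe
    fix S u w assume S: "finite S" "S \<subseteq> range v" "(\<Sum>y\<in>S. u y *\<^sub>R y) = 0" and w: "w \<in> S" "u w \<noteq> 0"
    obtain I where I: "S = v ` I" using S(2) by (meson subset_image_iff)
    have fI: "finite I" using S(1) I \<open>inj v\<close> by (auto dest: finite_imageD intro: inj_on_subset)
    define q where "q = (\<Sum>i\<in>I. monom (u (v i)) i)"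
    have "poly_op q T x = (\<Sum>i\<in>I. u (v i) *\<^sub>R v i)"
      by (simp add: q_def poly_op_sum[OF W(1) T x] poly_op_monom[OF W(1) T x] v_def)
    also have "\<dots> = 0"
      using S(3) unfolding I by (subst (asm) sum.reindex) (auto intro: inj_on_subset[OF \<open>inj v\<close>])
    finally have "q = 0" using nz by blast
    moreover obtain i where i: "i \<in> I" "w = v i" using w(1) I by blast
    have "coeff q i = u w" using i fI by (simp add: q_def coeff_sum)
    ultimately show False using w(2) by simp
  qed
  moreover obtain B where "finite B" "range v \<subseteq> span B"
    using W(2) endomorphism_onD(1)[OF endomorphism_on_funpow[OF T] x]
    unfolding finitely_spanned_def v_def by blast
  ultimately have "finite (range v)" using independent_span_bound by blast
  then show False using \<open>inj v\<close> by (metis finite_imageD infinite_UNIV_nat)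
qed

lemma annihilator_exists:
  fixes W :: "'a::real_vector set"
  assumes W: "subspace W" "finitely_spanned W" and T: "endomorphism_on W T"
  shows "\<exists>m. m \<noteq> 0 \<and> (\<forall>x\<in>W. poly_op m T x = 0)"
proof -
  obtain B where B: "finite B" "B \<subseteq> W" "span B = W" using finitely_spanned_basis[OF W] .
  obtain q where q: "\<And>b. b \<in> B \<Longrightarrow> q b \<noteq> 0 \<and> poly_op (q b) T b = 0"
    using vector_annihilator_exists[OF W T] B(2) by (metis subsetD)
  define m where "m = (\<Prod>b\<in>B. q b)"
  have e: "endomorphism_on W (poly_op m T)" by (rule endomorphism_on_poly_op[OF W(1) T])
  have "poly_op m T b = 0" if "b \<in> B" for b
  proof -
    have "m = prod q (B - {b}) * q b" using B(1) that by (simp add: m_def prod.remove mult.commute)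
    then show ?thesis
      using q[OF that] poly_op_mult[OF W(1) T, of b] that B(2)
        endomorphism_on_zero[OF W(1) endomorphism_on_poly_op[OF W(1) T]] by auto
  qed
  moreover have "subspace {x\<in>W. poly_op m T x = 0}"
    using endomorphism_on_zero[OF W(1) e]
    by (auto simp: subspace_def subspace_0[OF W(1)] subspace_add[OF W(1)] subspace_scale[OF W(1)]
        endomorphism_onD[OF e])
  ultimately have "span B \<subseteq> {x\<in>W. poly_op m T x = 0}"
    using B(2) by (intro span_minimal) auto
  moreover have "m \<noteq> 0" using q B(1) by (simp add: m_def)
  ultimately show ?thesis using B(3) by blast
qed

text \<open>
  Replacing an annihilating polynomial of \<open>T\<close> by its radical \<open>p\<close> makes \<open>p(T)\<close> nilpotent. The exponent
  is a successor in order to fit the number of steps of Newton's iteration.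
\<close>

lemma separable_nilpotent_exists:
  fixes W :: "'a::real_vector set"
  assumes W: "subspace W" "finitely_spanned W" and T: "endomorphism_on W T"
  shows "\<exists>p e. separable_poly p \<and> (\<forall>x\<in>W. \<forall>q. p ^ Suc e dvd q \<longrightarrow> poly_op q T x = 0)"
proof -
  obtain m where m: "m \<noteq> 0" "\<And>x. x \<in> W \<Longrightarrow> poly_op m T x = 0"
    using annihilator_exists[OF W T] by blast
  obtain p e where p: "separable_poly p" "m dvd p ^ e" using dvd_power_separable_poly[OF m(1)] by blast
  have "poly_op q T x = 0" if x: "x \<in> W" and q: "p ^ Suc e dvd q" for x q
  proof -
    have "m dvd q" using p(2) q by (metis dvd_mult dvd_trans power_Suc)
    then obtain k where "q = k * m" by (metis dvd_def mult.commute)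
    then show ?thesis
      using poly_op_mult[OF W(1) T x] m(2)[OF x]
        endomorphism_on_zero[OF W(1) endomorphism_on_poly_op[OF W(1) T]] by simp
  qed
  then show ?thesis using p(1) by blast
qed

text \<open>
  The kernel of a projection onto \<open>U\<close> that commutes with \<open>S\<close> is an invariant complement of \<open>U\<close>.
\<close>

lemma separable_on_imp_semisimple_on:
  assumes W: "subspace W" and S: "separable_on W S"
  shows "semisimple_on W S"
  unfolding semisimple_on_def
proof safe
  fix U assume U: "subspace U" "U \<subseteq> W" "S ` U \<subseteq> U"
  have Se: "endomorphism_on W S" using S by (simp add: separable_on_def)
  obtain \<pi> where \<pi>: "projection_onto W U \<pi>" "commute_on W S \<pi>"
    using projection_commuting_family[OF W, of "{S}" U] S U by (auto simp: commute_on_def)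
  have \<pi>e: "endomorphism_on W \<pi>" and \<pi>W: "\<And>y. y \<in> W \<Longrightarrow> \<pi> y \<in> U" and \<pi>id: "\<And>u. u \<in> U \<Longrightarrow> \<pi> u = u"
    using \<pi>(1) by (auto simp: projection_onto_def)
  define U' where "U' = {x\<in>W. \<pi> x = 0}"
  have U': "subspace U'"
    using endomorphism_on_zero[OF W \<pi>e]
    by (auto simp: U'_def subspace_def subspace_0[OF W] subspace_add[OF W] subspace_scale[OF W]
        endomorphism_onD[OF \<pi>e])
  have "S ` U' \<subseteq> U'"
    using endomorphism_on_zero[OF W Se] endomorphism_onD(1)[OF Se]
    by (auto simp: U'_def simp flip: commute_onD[OF \<pi>(2)])
  moreover have "U \<inter> U' = {0}"
    using \<pi>id subspace_0[OF U(1)] subspace_0[OF U'] by (auto simp: U'_def)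
  moreover have "W = {u + u' | u u'. u \<in> U \<and> u' \<in> U'}"
  proof safe
    fix x assume x: "x \<in> W"
    have "x - \<pi> x \<in> U'"
      using x \<pi>W[OF x] \<pi>id U(2) by (auto simp: U'_def endomorphism_on_diff[OF W \<pi>e] subspace_diff[OF W])
    then show "\<exists>u u'. x = u + u' \<and> u \<in> U \<and> u' \<in> U'"
      using \<pi>W[OF x] by (intro exI[of _ "\<pi> x"] exI[of _ "x - \<pi> x"]) auto
  qed (use U(2) in \<open>auto simp: U'_def intro!: subspace_add[OF W]\<close>)
  moreover have "U' \<subseteq> W" by (auto simp: U'_def)
  ultimately show "\<exists>U'. subspace U' \<and> U' \<subseteq> W \<and> S ` U' \<subseteq> U' \<and> U \<inter> U' = {0} \<and>
            W = {u + u' | u u'. u \<in> U \<and> u' \<in> U'}"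
    using U' by blast
qed

lemma semisimple_onD:
  assumes "semisimple_on W S" "subspace U" "S ` U \<subseteq> U" "U \<subseteq> W"
  shows "\<exists>U'. subspace U' \<and> U' \<subseteq> W \<and> S ` U' \<subseteq> U' \<and> U \<inter> U' = {0} \<and>
    (\<forall>x\<in>W. \<exists>u\<in>U. \<exists>u'\<in>U'. x = u + u')"
proof -
  obtain U' where "subspace U' \<and> U' \<subseteq> W \<and> S ` U' \<subseteq> U' \<and> U \<inter> U' = {0}"
      and W: "W = {u + u' | u u'. u \<in> U \<and> u' \<in> U'}"
    using assms(1)[unfolded semisimple_on_def, rule_format, OF conjI[OF assms(2) conjI[OF assms(4,3)]]]
    by (elim exE conjE, intro that conjI)
  moreover have "\<forall>x\<in>W. \<exists>u\<in>U. \<exists>u'\<in>U'. x = u + u'" by (subst W) blast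
  ultimately show ?thesis by (intro exI[of _ U']) simp
qed

text \<open>
  Let \<open>p(S)\<close> be nilpotent with \<open>p\<close> separable. On an invariant complement of its kernel, \<open>p(S)\<close> is
  injective and nilpotent. So the complement is zero and \<open>p(S) = 0\<close>.
\<close>

lemma semisimple_on_imp_separable_on:
  fixes W :: "'a::real_vector set"
  assumes W: "subspace W" "finitely_spanned W"
    and S: "endomorphism_on W S" and ss: "semisimple_on W S"
  shows "separable_on W S"
proof -
  obtain p e where p: "separable_poly p" "\<And>x q. x \<in> W \<Longrightarrow> p ^ Suc e dvd q \<Longrightarrow> poly_op q S x = 0"
    using separable_nilpotent_exists[OF W S] by metis
  let ?P = "poly_op p S"
  have P: "endomorphism_on W ?P" by (rule endomorphism_on_poly_op[OF W(1) S])
  define U where "U = {x\<in>W. ?P x = 0}"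
  have U: "subspace U"
    using endomorphism_on_zero[OF W(1) P]
    by (auto simp: U_def subspace_def subspace_0[OF W(1)] subspace_add[OF W(1)] subspace_scale[OF W(1)]
        endomorphism_onD[OF P])
  have "S ` U \<subseteq> U"
    using endomorphism_on_zero[OF W(1) S] endomorphism_onD(1)[OF S]
    by (auto simp: U_def poly_op_commute_self[OF W(1) S])
  moreover have "U \<subseteq> W" by (auto simp: U_def)
  ultimately obtain U' where U': "subspace U'" "U' \<subseteq> W" "S ` U' \<subseteq> U'" "U \<inter> U' = {0}"
      and sum: "\<And>x. x \<in> W \<Longrightarrow> \<exists>u\<in>U. \<exists>u'\<in>U'. x = u + u'"
    using semisimple_onD[OF ss U] by metis
  have SU': "endomorphism_on U' S" using endomorphism_on_restrict[OF S U'(2)] U'(3) by blast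
  have inj: "z = 0" if "z \<in> U'" "(?P ^^ m) z = 0" for m z
    using that
  proof (induction m arbitrary: z)
    case (Suc m)
    have "?P z = 0"
      using Suc.IH[OF poly_op_in[OF U'(1) SU' Suc.prems(1)]] Suc.prems(2) by (simp add: funpow_swap1)
    then have "z \<in> U \<inter> U'" using Suc.prems(1) U'(2) by (auto simp: U_def)
    then show ?case using U'(4) by blast
  qed simp
  have U'0: "u = 0" if "u \<in> U'" for u
  proof (rule inj[OF that, of "Suc e"])
    have "u \<in> W" using that U'(2) by blast
    then show "(?P ^^ Suc e) u = 0"
      using p(2)[of u "p ^ Suc e"] poly_op_power[OF W(1) S, of u p "Suc e"] by (simp del: power_Suc funpow.simps)
  qed
  have "?P x = 0" if "x \<in> W" for x
    using sum[OF that] U'0 by (fastforce simp: U_def)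
  then show ?thesis using S p(1) unfolding separable_on_def by blast
qed

text \<open>
  This is how sums of commuting semisimple operators are seen to be semisimple. If \<open>p\<close> is separable
  and \<open>p(E)\<close> is nilpotent, then \<open>p(E)\<close> vanishes, because it inherits from \<open>E\<close> that it commutes with
  everything that commutes with \<open>F\<close>.
\<close>

lemma separable_on_commuting_family:
  fixes W :: "'a::real_vector set"
  assumes W: "subspace W" "finitely_spanned W" and "finite F"
    and F: "\<And>S. S \<in> F \<Longrightarrow> separable_on W S"
      "\<And>S T. S \<in> F \<Longrightarrow> T \<in> F \<Longrightarrow> commute_on W S T"
    and E: "endomorphism_on W E"
    and gen: "\<And>\<pi>. endomorphism_on W \<pi> \<Longrightarrow> (\<And>S. S \<in> F \<Longrightarrow> commute_on W S \<pi>) \<Longrightarrow> commute_on W E \<pi>"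
  shows "separable_on W E"
proof -
  obtain p e where p: "separable_poly p" "\<And>x q. x \<in> W \<Longrightarrow> p ^ Suc e dvd q \<Longrightarrow> poly_op q E x = 0"
    using separable_nilpotent_exists[OF W E] by metis
  let ?P = "poly_op p E"
  have Pe: "endomorphism_on W ?P" by (rule endomorphism_on_poly_op[OF W(1) E])
  have "(?P ^^ Suc e) x = 0" if "x \<in> W" for x
    using p(2)[OF that dvd_refl] poly_op_power[OF W(1) E that, of p "Suc e"] by simp
  then have nil: "nilpotent_on W ?P" unfolding nilpotent_on_def by blast
  have P\<pi>: "commute_on W ?P \<pi>"
    if "endomorphism_on W \<pi>" "\<And>S. S \<in> F \<Longrightarrow> commute_on W S \<pi>" for \<pi>
    using poly_op_commute[where C = \<pi>, OF W(1) E that(1)] commute_onD[OF gen[OF that]]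
    by (simp add: commute_on_def)
  have SP: "commute_on W S ?P" if "S \<in> F" for S
    using P\<pi>[of S] F that by (auto simp: commute_on_sym[of W S] separable_on_def)
  have "?P x = 0" if "x \<in> W" for x
    using nilpotent_eq_zero[OF W(1) \<open>finite F\<close> F Pe nil SP P\<pi> that] by blast
  then show ?thesis using E p(1) unfolding separable_on_def by blast
qed

section \<open>The SN-decomposition\<close>

lemma SN_decomposition_exists:
  fixes W :: "'a::real_vector set"
  assumes W: "subspace W" "finitely_spanned W" and T: "endomorphism_on W T"
  shows "\<exists>s. SN_decomposition W T (poly_op s T) (\<lambda>x. T x - poly_op s T x)"
proof -
  obtain p e where p: "separable_poly p" "\<And>x q. x \<in> W \<Longrightarrow> p ^ Suc e dvd q \<Longrightarrow> poly_op q T x = 0"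
    using separable_nilpotent_exists[OF W T] by metis
  obtain s where s: "p ^ Suc e dvd pcompose p s" "p dvd s - [:0, 1:]"
    using separable_poly_newton[OF p(1)] by blast
  let ?S = "poly_op s T" and ?N = "\<lambda>x. T x - poly_op s T x"
  have S: "endomorphism_on W ?S" by (rule endomorphism_on_poly_op[OF W(1) T])
  have N: "endomorphism_on W ?N" by (rule endomorphism_on_sub[OF W(1) T S])
  have "poly_op p ?S x = 0" if "x \<in> W" for x
    using p(2)[OF that s(1)] poly_op_pcompose[OF W(1) T that] by simp
  then have "separable_on W ?S" using S p(1) unfolding separable_on_def by blast
  then have ss: "semisimple_on W ?S" by (rule separable_on_imp_semisimple_on[OF W(1)])
  let ?n = "[:0, 1:] - s"
  have n: "poly_op ?n T x = ?N x" if "x \<in> W" for x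
    using poly_op_diff[OF W(1) T that] poly_op_X[OF W(1) T] by simp
  have "p ^ Suc e dvd ?n ^ Suc e" using s(2) by (metis dvd_minus_iff dvd_power_same minus_diff_eq)
  then have "(poly_op ?n T ^^ Suc e) x = 0" if "x \<in> W" for x
    using p(2)[OF that] poly_op_power[OF W(1) T that, of ?n "Suc e"] by metis
  then have "nilpotent_on W (poly_op ?n T)" unfolding nilpotent_on_def by blast
  then have "nilpotent_on W ?N"
    by (rule nilpotent_on_cong[OF endomorphism_on_poly_op[OF W(1) T]]) (simp add: n)
  moreover have "?S (?N x) = ?N (?S x)" if x: "x \<in> W" for x
    using endomorphism_on_diff[OF W(1) S, of "T x" "?S x"] endomorphism_onD(1)[OF T x]
      poly_op_in[OF W(1) T x] poly_op_commute_self[OF W(1) T x] by simp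
  ultimately have "SN_decomposition W T ?S ?N"
    using S N ss by (simp add: SN_decomposition_def)
  then show ?thesis by blast
qed

lemma SN_decomposition_commute:
  assumes W: "subspace W" and SN: "SN_decomposition W T S N" and x: "x \<in> W"
  shows "S (T x) = T (S x)"
proof -
  have S: "endomorphism_on W S" and N: "endomorphism_on W N" and T: "\<And>x. x \<in> W \<Longrightarrow> T x = S x + N x"
    and "S (N x) = N (S x)"
    using SN x by (auto simp: SN_decomposition_def)
  then show ?thesis using x endomorphism_onD(1)[OF S x] endomorphism_onD(1)[OF N x]
    by (simp add: T endomorphism_onD(2)[OF S])
qed

lemma SN_decomposition_endomorphism:
  assumes W: "subspace W" and SN: "SN_decomposition W T S N"
  shows "endomorphism_on W T"
proof (rule endomorphism_on_cong)
  show "endomorphism_on W (\<lambda>x. S x + N x)"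
    using SN by (intro endomorphism_on_add[OF W]) (auto simp: SN_decomposition_def)
qed (use SN W in \<open>auto simp: SN_decomposition_def\<close>)

text \<open>
  \<open>S - S' = N' - N\<close> is nilpotent and a polynomial in the commuting semisimple operators \<open>S\<close> and \<open>S'\<close>.
\<close>

lemma SN_decomposition_commuting_unique:
  fixes W :: "'a::real_vector set"
  assumes W: "subspace W" "finitely_spanned W"
    and SN: "SN_decomposition W T S N" and SN': "SN_decomposition W T S' N'"
    and comm: "commute_on W S S'" and x: "x \<in> W"
  shows "S x = S' x"
proof -
  note W1 = W(1)
  have S: "endomorphism_on W S" "endomorphism_on W N" "separable_on W S" "nilpotent_on W N"
      "\<And>x. x \<in> W \<Longrightarrow> T x = S x + N x"
    using SN semisimple_on_imp_separable_on[OF W] by (auto simp: SN_decomposition_def)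
  have S': "endomorphism_on W S'" "endomorphism_on W N'" "separable_on W S'" "nilpotent_on W N'"
      "\<And>x. x \<in> W \<Longrightarrow> T x = S' x + N' x"
    using SN' semisimple_on_imp_separable_on[OF W] by (auto simp: SN_decomposition_def)
  let ?E = "\<lambda>x. S x - S' x"
  have E: "endomorphism_on W ?E" by (rule endomorphism_on_sub[OF W1 S(1) S'(1)])
  have N: "N x = T x - S x" "N' x = T x - S' x" if "x \<in> W" for x
    using S(5)[OF that] S'(5)[OF that] by (auto simp: algebra_simps)
  have T: "endomorphism_on W T" by (rule SN_decomposition_endomorphism[OF W1 SN])
  have NN: "commute_on W N' (\<lambda>x. - N x)"
    unfolding commute_on_def
  proof
    fix x assume x: "x \<in> W"
    have in_W: "T x \<in> W" "S x \<in> W" "S' x \<in> W" "N x \<in> W" "N' x \<in> W"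
      using x endomorphism_onD(1) T S(1,2) S'(1,2) by blast+
    have "N' (N x) = N (N' x)"
      using x in_W SN_decomposition_commute[OF W1 SN x] SN_decomposition_commute[OF W1 SN' x]
        commute_onD[OF comm x]
      by (simp add: N endomorphism_on_diff[OF W1] subspace_diff[OF W1] T S(1) S'(1))
    then show "N' (- N x) = - N (N' x)"
      using endomorphism_on_minus[OF S'(2) in_W(4)] by simp
  qed
  have nil: "nilpotent_on W (\<lambda>x. N' x + - N x)"
    by (rule nilpotent_on_add[OF W1 S'(2) endomorphism_on_uminus[OF W1 S(2)] NN S'(4)
          nilpotent_on_uminus[OF S(2,4)]])
  have nil_E: "nilpotent_on W ?E"
    by (rule nilpotent_on_cong[OF endomorphism_on_add[OF W1 S'(2) endomorphism_on_uminus[OF W1 S(2)]] nil])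
      (simp add: N)
  have SE: "commute_on W C ?E" if "C \<in> {S, S'}" for C
    using that comm endomorphism_onD(1)[OF S(1)] endomorphism_onD(1)[OF S'(1)]
    by (auto simp: commute_on_def endomorphism_on_diff[OF W1 S(1)] endomorphism_on_diff[OF W1 S'(1)])
  have "commute_on W ?E \<pi>"
    if "endomorphism_on W \<pi>" "\<And>C. C \<in> {S, S'} \<Longrightarrow> commute_on W C \<pi>" for \<pi>
    using that(2) endomorphism_onD(1)[OF S(1)] endomorphism_onD(1)[OF S'(1)]
    by (simp add: commute_on_def endomorphism_on_diff[OF W1 that(1)])
  moreover have "separable_on W C" if "C \<in> {S, S'}" for C using that S(3) S'(3) by auto
  moreover have "commute_on W C D" if "C \<in> {S, S'}" "D \<in> {S, S'}" for C D
    using that comm by (auto simp: commute_on_def)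
  ultimately have "?E x = 0"
    using nilpotent_eq_zero[OF W1 _ _ _ E nil_E SE _ x, of "{S, S'}"] by simp
  then show ?thesis by simp
qed

text \<open>
  The decomposition obtained from Newton's iteration has a semisimple part \<open>s(T)\<close>, which commutes with
  everything that commutes with \<open>T\<close>. So any decomposition can be compared with it.
\<close>

lemma SN_decomposition_unique:
  fixes W :: "'a::real_vector set"
  assumes W: "subspace W" "finitely_spanned W"
    and SN: "SN_decomposition W T S N" and SN': "SN_decomposition W T S' N'" and x: "x \<in> W"
  shows "S x = S' x" "N x = N' x"
proof -
  have T: "endomorphism_on W T" by (rule SN_decomposition_endomorphism[OF W(1) SN])
  obtain s where s: "SN_decomposition W T (poly_op s T) (\<lambda>x. T x - poly_op s T x)"
    using SN_decomposition_exists[OF W T] by blast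
  have "R x = poly_op s T x" if R: "SN_decomposition W T R M" for R M
  proof (rule SN_decomposition_commuting_unique[OF W R s _ x])
    show "commute_on W R (poly_op s T)"
      unfolding commute_on_def
    proof
      fix y assume "y \<in> W"
      have "endomorphism_on W R" using R by (simp add: SN_decomposition_def)
      then show "R (poly_op s T y) = poly_op s T (R y)"
        using poly_op_commute[where C = R, OF W(1) T _ _ \<open>y \<in> W\<close>] SN_decomposition_commute[OF W(1) R]
        by simp
    qed
  qed
  from this[OF SN] this[OF SN'] show "S x = S' x" by simp
  moreover have "T x = S x + N x" "T x = S' x + N' x"
    using SN SN' x by (auto simp: SN_decomposition_def)
  ultimately show "N x = N' x" by simp
qed

lemma SN_decomposition_cong:
  assumes W: "subspace W" and SN: "SN_decomposition W T S N"
    and "\<And>x. x \<in> W \<Longrightarrow> S' x = S x" "\<And>x. x \<in> W \<Longrightarrow> N' x = N x" "\<And>x. x \<in> W \<Longrightarrow> T' x = T x"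
  shows "SN_decomposition W T' S' N'"
proof -
  have S: "endomorphism_on W S" "endomorphism_on W N" "semisimple_on W S" "nilpotent_on W N"
      "\<forall>x\<in>W. T x = S x + N x" "\<forall>x\<in>W. S (N x) = N (S x)"
    using SN by (auto simp: SN_decomposition_def)
  have img: "S' ` U = S ` U" if "U \<subseteq> W" for U
    by (rule image_cong) (use that assms(3) in auto)
  have "semisimple_on W S' \<longleftrightarrow> semisimple_on W S"
    unfolding semisimple_on_def by (simp add: img cong: conj_cong)
  then have "semisimple_on W S'" using S(3) by simp
  moreover have "nilpotent_on W N'" by (rule nilpotent_on_cong[OF S(2,4) assms(4)])
  moreover have "\<forall>x\<in>W. T' x = S' x + N' x" "\<forall>x\<in>W. S' (N' x) = N' (S' x)"
    using S(5,6) endomorphism_onD(1)[OF S(1)] endomorphism_onD(1)[OF S(2)] assms(3-5) by auto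
  ultimately show ?thesis
    using endomorphism_on_cong[OF S(1) W assms(3)] endomorphism_on_cong[OF S(2) W assms(4)]
    by (simp add: SN_decomposition_def)
qed

lemma semisimple_part_eq:
  fixes W :: "'a::real_vector set"
  assumes W: "subspace W" "finitely_spanned W" and SN: "SN_decomposition W T S N"
  shows "semisimple_part W T = restrict S W"
  unfolding semisimple_part_def
proof (rule the_equality)
  have "SN_decomposition W T (restrict S W) N"
    by (rule SN_decomposition_cong[OF W(1) SN]) auto
  then show "restrict S W \<in> extensional W \<and> (\<exists>N. SN_decomposition W T (restrict S W) N)" by auto
  fix S' assume "S' \<in> extensional W \<and> (\<exists>N. SN_decomposition W T S' N)"
  then show "S' = restrict S W"
    using SN_decomposition_unique(1)[OF W SN] by (auto intro!: extensionalityI[of _ W])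
qed

lemma nilpotent_part_eq:
  fixes W :: "'a::real_vector set"
  assumes W: "subspace W" "finitely_spanned W" and SN: "SN_decomposition W T S N"
  shows "nilpotent_part W T = restrict N W"
  unfolding nilpotent_part_def
proof (rule the_equality)
  have "SN_decomposition W T S (restrict N W)"
    by (rule SN_decomposition_cong[OF W(1) SN]) auto
  then show "restrict N W \<in> extensional W \<and> (\<exists>S. SN_decomposition W T S (restrict N W))" by auto
  fix N' assume "N' \<in> extensional W \<and> (\<exists>S. SN_decomposition W T S N')"
  then show "N' = restrict N W"
    using SN_decomposition_unique(2)[OF W SN] by (auto intro!: extensionalityI[of _ W])
qed

lemma endomorphism_on_image:
  assumes W: "subspace W" and \<Phi>: "linear \<Phi>" and T: "endomorphism_on W T"
    and \<Phi>T: "\<And>x. x \<in> W \<Longrightarrow> \<Phi> (T x) = T' (\<Phi> x)"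
  shows "endomorphism_on (\<Phi> ` W) T'"
proof (rule endomorphism_onI)
  fix y z c assume "y \<in> \<Phi> ` W" "z \<in> \<Phi> ` W"
  then obtain u v where u: "u \<in> W" "y = \<Phi> u" and v: "v \<in> W" "z = \<Phi> v" by blast
  show "T' (y + z) = T' y + T' z"
    using \<Phi>T[OF subspace_add[OF W u(1) v(1)]] \<Phi>T[OF u(1)] \<Phi>T[OF v(1)]
    by (simp add: u v endomorphism_onD(2)[OF T] linear_add[OF \<Phi>])
next
  fix y c assume "y \<in> \<Phi> ` W"
  then obtain u where u: "u \<in> W" "y = \<Phi> u" by blast
  show "T' y \<in> \<Phi> ` W"
    using imageI[OF endomorphism_onD(1)[OF T u(1)], of \<Phi>] \<Phi>T[OF u(1)] u(2) by simp
  show "T' (c *\<^sub>R y) = c *\<^sub>R T' y"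
    using \<Phi>T[OF subspace_scale[OF W u(1)]] \<Phi>T[OF u(1)]
    by (simp add: u endomorphism_onD(3)[OF T] linear_scale[OF \<Phi>])
qed

lemma separable_on_image:
  assumes W: "subspace W" and \<Phi>: "linear \<Phi>" and S: "separable_on W S"
    and \<Phi>S: "\<And>x. x \<in> W \<Longrightarrow> \<Phi> (S x) = S' (\<Phi> x)"
  shows "separable_on (\<Phi> ` W) S'"
proof -
  have Se: "endomorphism_on W S" using S by (simp add: separable_on_def)
  obtain p where p: "separable_poly p" "\<And>x. x \<in> W \<Longrightarrow> poly_op p S x = 0"
    using S by (auto simp: separable_on_def)
  have "poly_op p S' (\<Phi> x) = 0" if x: "x \<in> W" for x
  proof -
    have "poly_op p S' (\<Phi> x) = \<Phi> (poly_op p S x)"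
      by (rule poly_op_intertwine_linear[where T' = S', OF W Se \<Phi> \<Phi>S x, symmetric])
    also have "\<dots> = 0" by (simp only: p(2)[OF x] linear_0[OF \<Phi>])
    finally show ?thesis .
  qed
  then show ?thesis
    using endomorphism_on_image[OF W \<Phi> Se \<Phi>S] p(1) unfolding separable_on_def by blast
qed

lemma nilpotent_on_image:
  assumes \<Phi>: "linear \<Phi>" and N: "endomorphism_on W N" "nilpotent_on W N"
    and \<Phi>N: "\<And>x. x \<in> W \<Longrightarrow> \<Phi> (N x) = N' (\<Phi> x)"
  shows "nilpotent_on (\<Phi> ` W) N'"
proof -
  obtain m where m: "\<forall>x\<in>W. (N ^^ m) x = 0" using N(2) by (auto simp: nilpotent_on_def)
  have pow: "\<Phi> ((N ^^ k) x) = (N' ^^ k) (\<Phi> x)" if x: "x \<in> W" for k x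
  proof (induction k)
    case (Suc k)
    have "(N ^^ k) x \<in> W" by (rule endomorphism_onD(1)[OF endomorphism_on_funpow[OF N(1)] x])
    from \<Phi>N[OF this] Suc show ?case by simp
  qed simp
  have "(N' ^^ m) y = 0" if y: "y \<in> \<Phi> ` W" for y
  proof -
    obtain x where x: "x \<in> W" "y = \<Phi> x" using y by blast
    then have "(N' ^^ m) y = \<Phi> ((N ^^ m) x)" by (simp only: pow)
    also have "\<dots> = 0" by (simp only: bspec[OF m x(1)] linear_0[OF \<Phi>])
    finally show ?thesis .
  qed
  then show ?thesis unfolding nilpotent_on_def by blast
qed

lemma SN_decompositionI:
  assumes W: "subspace W" and "separable_on W S" "endomorphism_on W N" "nilpotent_on W N"
    and "\<And>x. x \<in> W \<Longrightarrow> T x = S x + N x" "commute_on W S N"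
  shows "SN_decomposition W T S N"
  using assms separable_on_imp_semisimple_on[OF W assms(2)]
  by (auto simp: SN_decomposition_def separable_on_def commute_on_def)

lemma SN_decompositionD:
  assumes "subspace W" "finitely_spanned W" "SN_decomposition W T S N"
  shows "separable_on W S" "endomorphism_on W S" "endomorphism_on W N" "nilpotent_on W N"
    "x \<in> W \<Longrightarrow> T x = S x + N x" "commute_on W S N"
  using assms semisimple_on_imp_separable_on[OF assms(1,2)]
  by (auto simp: SN_decomposition_def commute_on_def)

lemma SN_decomposition_image:
  assumes W: "subspace W" "finitely_spanned W" and \<Phi>: "linear \<Phi>" and SN: "SN_decomposition W T S N"
    and \<Phi>T: "\<And>x. x \<in> W \<Longrightarrow> \<Phi> (T x) = T' (\<Phi> x)"
    and \<Phi>S: "\<And>x. x \<in> W \<Longrightarrow> \<Phi> (S x) = S' (\<Phi> x)"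
    and \<Phi>N: "\<And>x. x \<in> W \<Longrightarrow> \<Phi> (N x) = N' (\<Phi> x)"
  shows "SN_decomposition (\<Phi> ` W) T' S' N'"
proof (rule SN_decompositionI)
  note D = SN_decompositionD[OF W SN]
  show "subspace (\<Phi> ` W)" by (rule linear_subspace_image[OF \<Phi> W(1)])
  show "separable_on (\<Phi> ` W) S'" by (rule separable_on_image[OF W(1) \<Phi> D(1) \<Phi>S])
  show "endomorphism_on (\<Phi> ` W) N'" by (rule endomorphism_on_image[OF W(1) \<Phi> D(3) \<Phi>N])
  show "nilpotent_on (\<Phi> ` W) N'" by (rule nilpotent_on_image[OF \<Phi> D(3,4) \<Phi>N])
  show "T' y = S' y + N' y" if y: "y \<in> \<Phi> ` W" for y
  proof -
    obtain x where x: "x \<in> W" "y = \<Phi> x" using y by blast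
    have "\<Phi> (T x) = \<Phi> (S x) + \<Phi> (N x)" by (simp only: D(5)[OF x(1)] linear_add[OF \<Phi>])
    then show ?thesis by (simp only: x(2) \<Phi>T[OF x(1)] \<Phi>S[OF x(1)] \<Phi>N[OF x(1)])
  qed
  show "commute_on (\<Phi> ` W) S' N'"
    unfolding commute_on_def
  proof
    fix y assume "y \<in> \<Phi> ` W"
    then obtain x where x: "x \<in> W" "y = \<Phi> x" by blast
    show "S' (N' y) = N' (S' y)"
      using \<Phi>S[OF endomorphism_onD(1)[OF D(3) x(1)]] \<Phi>N[OF endomorphism_onD(1)[OF D(2) x(1)]]
        \<Phi>S[OF x(1)] \<Phi>N[OF x(1)] commute_onD[OF D(6) x(1)] by (simp add: x(2))
  qed
qed

lemma SN_decomposition_restrict: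
  assumes W: "subspace W" "finitely_spanned W" and SN: "SN_decomposition W T S N"
    and U: "subspace U" "U \<subseteq> W" "\<And>x. x \<in> U \<Longrightarrow> S x \<in> U" "\<And>x. x \<in> U \<Longrightarrow> N x \<in> U"
  shows "SN_decomposition U T S N"
proof (rule SN_decompositionI[OF U(1)])
  note D = SN_decompositionD[OF W SN]
  show "separable_on U S"
    using D(1) U(2) endomorphism_on_restrict[OF D(2) U(2,3)] unfolding separable_on_def by blast
  show "endomorphism_on U N" by (rule endomorphism_on_restrict[OF D(3) U(2,4)])
  show "nilpotent_on U N" using D(4) U(2) unfolding nilpotent_on_def by blast
  show "T x = S x + N x" if "x \<in> U" for x using D(5) that U(2) by blast
  show "commute_on U S N" using D(6) U(2) unfolding commute_on_def by blast
qed

text \<open>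
  \<open>\<Phi>\<close> intertwines \<open>s(T)\<close> with \<open>s(T')\<close>, and these are the semisimple parts of \<open>T\<close> and of \<open>T'\<close> on the
  image by uniqueness. With \<open>\<Phi> = \<gamma>\<close> this lets the decomposition descend to \<open>P^k / ker \<gamma>\<close>.
\<close>

lemma SN_decomposition_transfer:
  fixes W :: "'a::real_vector set" and \<Phi> :: "'a \<Rightarrow> 'b::real_vector"
  assumes W: "subspace W" "finitely_spanned W" and \<Phi>: "linear \<Phi>"
    and T: "endomorphism_on W T" and \<Phi>T: "\<And>x. x \<in> W \<Longrightarrow> \<Phi> (T x) = T' (\<Phi> x)"
    and SN: "SN_decomposition W T S N" and SN': "SN_decomposition (\<Phi> ` W) T' S' N'" and x: "x \<in> W"
  shows "\<Phi> (S x) = S' (\<Phi> x)" "\<Phi> (N x) = N' (\<Phi> x)"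
proof -
  obtain s where s: "SN_decomposition W T (poly_op s T) (\<lambda>x. T x - poly_op s T x)"
    using SN_decomposition_exists[OF W T] by blast
  let ?Y = "\<Phi> ` W"
  have Y: "subspace ?Y" "finitely_spanned ?Y"
    using W \<Phi> by (auto simp: linear_subspace_image finitely_spanned_linear_image)
  let ?S = "poly_op s T" and ?S' = "poly_op s T'" and ?N' = "\<lambda>x. T' x - poly_op s T' x"
  have \<Phi>S: "\<Phi> (?S x) = ?S' (\<Phi> x)" if "x \<in> W" for x
    by (rule poly_op_intertwine_linear[where T' = T', OF W(1) T \<Phi> \<Phi>T that])
  have "SN_decomposition ?Y T' ?S' ?N'"
    by (rule SN_decomposition_image[OF W \<Phi> s \<Phi>T \<Phi>S]) (simp_all only: linear_diff[OF \<Phi>] \<Phi>T \<Phi>S)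
  then have "S' (\<Phi> x) = ?S' (\<Phi> x)" using SN_decomposition_unique(1)[OF Y SN'] x by blast
  moreover have "S x = ?S x" using SN_decomposition_unique(1)[OF W SN s x] .
  ultimately show *: "\<Phi> (S x) = S' (\<Phi> x)" using \<Phi>S[OF x] by simp
  have "N x = T x - S x" "N' (\<Phi> x) = T' (\<Phi> x) - S' (\<Phi> x)"
    using SN SN' x by (auto simp: SN_decomposition_def)
  then show "\<Phi> (N x) = N' (\<Phi> x)" using * \<Phi>T[OF x] by (simp add: linear_diff[OF \<Phi>])
qed

section \<open>Finite dimensional normed spaces\<close>

text \<open>
  The bound makes the coordinates of a convergent sequence Cauchy sequences.
\<close>

lemma closed_span_of_coordinate_bound:
  fixes B :: "'a::real_normed_vector set"
  assumes "finite B" "c > 0" and c: "\<And>a. c * (\<Sum>b\<in>B. \<bar>a b\<bar>) \<le> norm (\<Sum>b\<in>B. a b *\<^sub>R b)"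
  shows "closed (span B)"
  unfolding closed_sequential_limits
proof (intro allI impI, elim conjE)
  fix w l assume w: "\<forall>n. w n \<in> span B" and l: "w \<longlonglongrightarrow> l"
  have "\<forall>n. \<exists>a. w n = (\<Sum>b\<in>B. a b *\<^sub>R b)"
    using w span_finite[OF \<open>finite B\<close>] by auto
  then obtain a where a: "\<And>n. w n = (\<Sum>b\<in>B. a n b *\<^sub>R b)" by metis
  have "Cauchy (\<lambda>n. a n b)" if b: "b \<in> B" for b
  proof (rule metric_CauchyI)
    fix e :: real assume "e > 0"
    then have "c * e > 0" using \<open>c > 0\<close> by simp
    then obtain M where M: "\<And>m n. m \<ge> M \<Longrightarrow> n \<ge> M \<Longrightarrow> dist (w m) (w n) < c * e"
      using metric_CauchyD[OF LIMSEQ_imp_Cauchy[OF l]] by metis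
    have "dist (a m b) (a n b) < e" if "m \<ge> M" "n \<ge> M" for m n
    proof -
      have "c * \<bar>a m b - a n b\<bar> \<le> c * (\<Sum>b\<in>B. \<bar>a m b - a n b\<bar>)"
        using \<open>c > 0\<close> b \<open>finite B\<close> by (intro mult_left_mono member_le_sum) auto
      also have "\<dots> \<le> norm (w m - w n)"
        using c[of "\<lambda>b. a m b - a n b"] by (simp add: a sum_subtractf algebra_simps)
      also have "\<dots> < c * e" using M[OF that] by (simp add: dist_norm)
      finally show ?thesis using \<open>c > 0\<close> by (simp add: dist_real_def)
    qed
    then show "\<exists>M. \<forall>m\<ge>M. \<forall>n\<ge>M. dist (a m b) (a n b) < e" by blast
  qed
  then have "\<forall>b\<in>B. \<exists>A. (\<lambda>n. a n b) \<longlonglongrightarrow> A"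
    using Cauchy_convergent_iff convergent_def by blast
  then obtain A where A: "\<And>b. b \<in> B \<Longrightarrow> (\<lambda>n. a n b) \<longlonglongrightarrow> A b" by metis
  have "w \<longlonglongrightarrow> (\<Sum>b\<in>B. A b *\<^sub>R b)"
    unfolding a[abs_def] by (intro tendsto_sum tendsto_scaleR A tendsto_const)
  then have "l = (\<Sum>b\<in>B. A b *\<^sub>R b)" using l LIMSEQ_unique by blast
  then show "l \<in> span B" by (simp add: span_sum span_scale span_base)
qed

text \<open>
  Equivalence of norms, by induction on the basis: a new basis vector \<open>v\<close> has a positive distance
  \<open>\<delta>\<close> from the span of the others, because that span is closed.
\<close>

lemma coordinate_bound_exists:
  fixes B :: "'a::real_normed_vector set"
  assumes "finite B" "independent B"
  shows "\<exists>c>0. \<forall>a. c * (\<Sum>b\<in>B. \<bar>a b\<bar>) \<le> norm (\<Sum>b\<in>B. a b *\<^sub>R b)"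
  using assms
proof (induction B)
  case empty
  then show ?case by (intro exI[of _ 1]) auto
next
  case (insert v B)
  then have ind: "independent B" "v \<notin> span B"
    by (auto simp: independent_insert)
  then obtain c where c: "c > 0" "\<And>a. c * (\<Sum>b\<in>B. \<bar>a b\<bar>) \<le> norm (\<Sum>b\<in>B. a b *\<^sub>R b)"
    using insert.IH by blast
  have "open (- span B)"
    using closed_span_of_coordinate_bound[OF insert.hyps(1) c] by (simp add: open_Compl)
  then obtain \<delta> where \<delta>: "\<delta> > 0" "ball v \<delta> \<subseteq> - span B"
    using ind(2) by (meson ComplI openE)
  have far: "\<bar>t\<bar> * \<delta> \<le> norm (t *\<^sub>R v + w)" if w: "w \<in> span B" for t w
  proof (cases "t = 0")
    case False
    have "(- (1 / t)) *\<^sub>R w \<in> span B" using w by (rule span_scale)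
    then have "\<delta> \<le> norm (v - (- (1 / t)) *\<^sub>R w)"
      using \<delta>(2) by (force simp: dist_norm subset_iff not_less)
    then have "\<bar>t\<bar> * \<delta> \<le> norm (t *\<^sub>R (v - (- (1 / t)) *\<^sub>R w))"
      by (simp add: mult_left_mono)
    also have "t *\<^sub>R (v - (- (1 / t)) *\<^sub>R w) = t *\<^sub>R v + w"
      using False by (simp add: algebra_simps)
    finally show ?thesis .
  qed simp
  \<comment> \<open>the reciprocal of the new constant; the summands bound the coefficient of \<open>v\<close>, and the other coefficients via the triangle inequality\<close>
  define K where "K = 1 / \<delta> + 1 / c + norm v / (\<delta> * c)"
  have K: "K > 0" using \<delta>(1) c(1) by (auto simp: K_def intro!: add_pos_nonneg)
  have "1 / K * (\<Sum>b\<in>insert v B. \<bar>a b\<bar>) \<le> norm (\<Sum>b\<in>insert v B. a b *\<^sub>R b)" for a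
  proof -
    define w X where "w = (\<Sum>b\<in>B. a b *\<^sub>R b)" and "X = norm (a v *\<^sub>R v + w)"
    have "w \<in> span B" by (simp add: w_def span_sum span_scale span_base)
    then have 1: "\<bar>a v\<bar> \<le> X / \<delta>" using far[of w "a v"] \<delta>(1) by (simp add: X_def pos_le_divide_eq)
    have "norm w \<le> X + \<bar>a v\<bar> * norm v"
      unfolding X_def using norm_triangle_ineq4[of "a v *\<^sub>R v + w" "a v *\<^sub>R v"] by simp
    also have "\<dots> \<le> X + X / \<delta> * norm v" using 1 by (intro add_left_mono mult_right_mono) auto
    finally have "c * (\<Sum>b\<in>B. \<bar>a b\<bar>) \<le> X + X / \<delta> * norm v" using c(2)[of a] by (simp add: w_def)
    then have "(\<Sum>b\<in>B. \<bar>a b\<bar>) \<le> (X + X / \<delta> * norm v) / c"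
      using c(1) by (simp add: pos_le_divide_eq mult.commute)
    then have "(\<Sum>b\<in>insert v B. \<bar>a b\<bar>) \<le> X / \<delta> + (X + X / \<delta> * norm v) / c"
      using 1 insert.hyps by simp
    also have "\<dots> = K * X" using c(1) \<delta>(1) by (simp add: K_def algebra_simps add_divide_distrib)
    finally show ?thesis
      using K insert.hyps by (simp add: X_def w_def pos_divide_le_eq mult.commute)
  qed
  then show ?case using K by (intro exI[of _ "1 / K"]) simp
qed

text \<open>
  Linear maps have derivatives in the sense of normed spaces only because of this continuity; the space
  \<open>V\<close> carries a norm but no inner product.
\<close>

lemma bounded_linear_finite_dimensional:
  fixes f :: "'a::real_normed_vector \<Rightarrow> 'b::real_normed_vector"
  assumes "finite_dimensional TYPE('a)" and f: "linear f"
  shows "bounded_linear f"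
proof -
  have "finitely_spanned (UNIV :: 'a set)"
    using assms(1) by (auto simp: finite_dimensional_def finitely_spanned_def)
  then obtain C :: "'a set" where C: "finite C" "UNIV \<subseteq> span C" by (auto simp: finitely_spanned_def)
  obtain B :: "'a set" where "B \<subseteq> UNIV" and B: "independent B" "UNIV \<subseteq> span B"
    using maximal_independent_subset[of UNIV] .
  have "finite B" using independent_span_bound[OF C(1) B(1)] C(2) by blast
  obtain c where c: "c > 0" "\<And>a. c * (\<Sum>b\<in>B. \<bar>a b\<bar>) \<le> norm (\<Sum>b\<in>B. a b *\<^sub>R b)"
    using coordinate_bound_exists[OF \<open>finite B\<close> B(1)] by blast
  show ?thesis
  proof (rule bounded_linear_intro)
    show "f (x + y) = f x + f y" "f (r *\<^sub>R x) = r *\<^sub>R f x" for x y r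
      by (rule linear_add[OF f], rule linear_scale[OF f])
    show "norm (f x) \<le> norm x * ((\<Sum>b\<in>B. norm (f b)) / c)" for x
    proof -
      have "x \<in> range (\<lambda>a. \<Sum>b\<in>B. a b *\<^sub>R b)" using B(2) span_finite[OF \<open>finite B\<close>] by blast
      then obtain a where x: "x = (\<Sum>b\<in>B. a b *\<^sub>R b)" by blast
      have "norm (f x) \<le> (\<Sum>b\<in>B. \<bar>a b\<bar> * norm (f b))"
        unfolding x linear_sum[OF f] linear_scale[OF f] by (rule order.trans[OF norm_sum]) simp
      also have "\<dots> \<le> (\<Sum>b\<in>B. \<bar>a b\<bar> * (\<Sum>b\<in>B. norm (f b)))"
        using \<open>finite B\<close> by (intro sum_mono mult_left_mono member_le_sum) auto
      also have "\<dots> = (\<Sum>b\<in>B. \<bar>a b\<bar>) * (\<Sum>b\<in>B. norm (f b))" by (simp add: sum_distrib_right)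
      also have "\<dots> \<le> (norm x / c) * (\<Sum>b\<in>B. norm (f b))"
        using c(2)[of a] c(1) x
        by (intro mult_right_mono) (auto simp: pos_le_divide_eq mult.commute intro: sum_nonneg)
      finally show ?thesis by simp
    qed
  qed
qed

lemma vec_eq_sum_axis: "x = (\<Sum>i\<in>UNIV. axis i (x $ i :: 'a::real_vector))"
  by (simp add: vec_eq_iff axis_def if_distrib[of "\<lambda>f. f _"] sum.delta' cong: if_cong)

lemma linear_axis: "linear (axis i :: 'a::real_vector \<Rightarrow> 'a ^ 'n)"
  by (rule linearI) (auto simp: vec_eq_iff axis_def)

lemma finite_dimensional_vec:
  assumes "finite_dimensional TYPE('a::real_vector)"
  shows "finite_dimensional TYPE('a ^ 'n)"
proof -
  obtain B :: "'a set" where B: "finite B" "span B = UNIV"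
    using assms by (auto simp: finite_dimensional_def)
  define C where "C = (\<Union>i. (axis i :: 'a \<Rightarrow> 'a ^ 'n) ` B)"
  have "axis i a \<in> span C" for i :: 'n and a :: 'a
  proof -
    have "axis i a \<in> span (axis i ` B)"
      using linear_span_image[OF linear_axis[of i], of B] B(2) by auto
    moreover have "span (axis i ` B) \<subseteq> span C" by (rule span_mono) (auto simp: C_def)
    ultimately show ?thesis by blast
  qed
  then have "x \<in> span C" for x :: "'a ^ 'n"
    by (subst vec_eq_sum_axis) (rule span_sum)
  moreover have "finite C" using B(1) by (simp add: C_def)
  ultimately show ?thesis unfolding finite_dimensional_def by blast
qed

section \<open>Derivations on multilinear maps\<close>

definition product_map :: "'i set \<Rightarrow> ('i \<Rightarrow> 'a \<Rightarrow> real) \<Rightarrow> 'b::real_vector \<Rightarrow> ('i \<Rightarrow> 'a) \<Rightarrow> 'b"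
  where "product_map I l v = (\<lambda>x. (\<Prod>i\<in>I. l i (x i)) *\<^sub>R v)"

text \<open>
  Multilinear maps in variables indexed by \<open>I\<close>, as functions of families that depend only on the
  entries in \<open>I\<close>. Since such maps are functions, operators on them can be defined without choosing a
  presentation as a sum of products.
\<close>

definition tensors :: "'i set \<Rightarrow> (('i \<Rightarrow> 'a::real_vector) \<Rightarrow> 'b::real_vector) set"
  where "tensors I = span {product_map I l v | l v. \<forall>i\<in>I. linear (l i)}"

definition precompose_slot :: "('a \<Rightarrow> 'a) \<Rightarrow> 'i \<Rightarrow> (('i \<Rightarrow> 'a) \<Rightarrow> 'b) \<Rightarrow> ('i \<Rightarrow> 'a) \<Rightarrow> 'b"
  where "precompose_slot A i M = (\<lambda>x. M (x(i := A (x i))))"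

text \<open>
  The infinitesimal action of \<open>A\<close> on multilinear maps. It lifts the bracket with the linear vector field
  \<open>A\<close> from homogeneous polynomial maps and, unlike the bracket, is visibly a sum of commuting operators.
\<close>

definition derivation ::
    "'i set \<Rightarrow> ('a::real_vector \<Rightarrow> 'a) \<Rightarrow> (('i \<Rightarrow> 'a) \<Rightarrow> 'a) \<Rightarrow> ('i \<Rightarrow> 'a) \<Rightarrow> 'a"
  where "derivation I A M = (A \<circ> M) + - (\<Sum>i\<in>I. precompose_slot A i M)"

lemma subspace_tensors: "subspace (tensors I)"
  by (simp add: tensors_def)

lemma tensors_induct [consumes 1, case_names product zero add scale]:
  assumes "M \<in> tensors I"
    and "\<And>l v. (\<And>i. i \<in> I \<Longrightarrow> linear (l i)) \<Longrightarrow> P (product_map I l v)"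
    and "P 0" "\<And>M M'. M \<in> tensors I \<Longrightarrow> M' \<in> tensors I \<Longrightarrow> P M \<Longrightarrow> P M' \<Longrightarrow> P (M + M')"
    and "\<And>c M. M \<in> tensors I \<Longrightarrow> P M \<Longrightarrow> P (c *\<^sub>R M)"
  shows "P M"
proof -
  have "P M \<and> M \<in> tensors I"
    using assms(1) unfolding tensors_def
  proof (induction rule: span_induct_alt)
    case base
    show ?case using assms(3) span_zero by blast
  next
    case (step c x y)
    then obtain l v where x: "x = product_map I l v" "\<And>i. i \<in> I \<Longrightarrow> linear (l i)" by blast
    have "x \<in> tensors I" using step(1) by (simp add: tensors_def span_base)
    moreover have "P x" using assms(2) x by blast
    ultimately have "P (c *\<^sub>R x)" "c *\<^sub>R x \<in> tensors I"
      using assms(5) subspace_scale[OF subspace_tensors] by blast+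
    moreover have "P y" "y \<in> tensors I" using step(2) by (auto simp: tensors_def)
    ultimately have "P (c *\<^sub>R x + y)" "c *\<^sub>R x + y \<in> tensors I"
      using assms(4) subspace_add[OF subspace_tensors] by blast+
    then show ?case unfolding tensors_def by blast
  qed
  then show ?thesis by blast
qed

lemma product_map_in_tensors: "(\<And>i. i \<in> I \<Longrightarrow> linear (l i)) \<Longrightarrow> product_map I l v \<in> tensors I"
  unfolding tensors_def by (rule span_base) blast

lemma product_map_update:
  assumes "finite I" "i \<in> I"
  shows "product_map I l v (x(i := e)) = l i e *\<^sub>R (\<Prod>j\<in>I - {i}. l j (x j)) *\<^sub>R v"
proof -
  have "(\<Prod>j\<in>I. l j ((x(i := e)) j)) = l i e * (\<Prod>j\<in>I - {i}. l j ((x(i := e)) j))"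
    using prod.remove[OF assms, of "\<lambda>j. l j ((x(i := e)) j)"] by simp
  also have "(\<Prod>j\<in>I - {i}. l j ((x(i := e)) j)) = (\<Prod>j\<in>I - {i}. l j (x j))"
    by (rule prod.cong) auto
  finally show ?thesis by (simp add: product_map_def)
qed

lemma tensors_linear_slot:
  assumes "M \<in> tensors I" "finite I" "i \<in> I"
  shows "linear (\<lambda>e. M (x(i := e)))"
  using assms(1)
proof (induction rule: tensors_induct)
  case (product l v)
  then have l: "linear (l i)" using assms(3) by blast
  show ?case
    unfolding product_map_update[OF assms(2,3)]
    by (intro linearI) (simp_all add: linear_add[OF l] linear_scale[OF l] algebra_simps)
next
  case zero
  then show ?case by (intro linearI) (simp_all add: zero_fun_def)
next
  case (add M M')
  then show ?case by (simp add: plus_fun_def linear_compose_add)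
next
  case (scale c M)
  then show ?case by (simp add: scaleR_fun_def linear_compose_scale_right)
qed

lemma precompose_slot_product_map:
  assumes "finite I" "i \<in> I"
  shows "precompose_slot A i (product_map I l v) = product_map I (l(i := l i \<circ> A)) v"
proof
  fix x
  have "product_map I (l(i := l i \<circ> A)) v x = product_map I (l(i := l i \<circ> A)) v (x(i := x i))"
    by simp
  also have "\<dots> = l i (A (x i)) *\<^sub>R (\<Prod>j\<in>I - {i}. (l(i := l i \<circ> A)) j (x j)) *\<^sub>R v"
    unfolding product_map_update[OF assms] by simp
  also have "(\<Prod>j\<in>I - {i}. (l(i := l i \<circ> A)) j (x j)) = (\<Prod>j\<in>I - {i}. l j (x j))"
    by (rule prod.cong) auto
  finally show "precompose_slot A i (product_map I l v) x = product_map I (l(i := l i \<circ> A)) v x"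
    by (simp only: precompose_slot_def product_map_update[OF assms])
qed

lemma precompose_slot_linear:
  "precompose_slot A i (M + M') = precompose_slot A i M + precompose_slot A i M'"
  "precompose_slot A i (c *\<^sub>R M) = c *\<^sub>R precompose_slot A i M"
  by (auto simp: precompose_slot_def plus_fun_def scaleR_fun_def)

lemma endomorphism_on_precompose_slot:
  fixes A :: "'a::real_vector \<Rightarrow> 'a"
  assumes A: "linear A" and I: "finite I" "i \<in> I"
  shows "endomorphism_on (tensors I :: (('i \<Rightarrow> 'a) \<Rightarrow> 'b::real_vector) set) (precompose_slot A i)"
proof (rule endomorphism_onI)
  fix M :: "('i \<Rightarrow> 'a) \<Rightarrow> 'b" assume "M \<in> tensors I"
  then show "precompose_slot A i M \<in> tensors I"
  proof (induction rule: tensors_induct)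
    case (product l v)
    then show ?case
      using linear_compose[OF A, of "l i"] I
      by (auto simp: precompose_slot_product_map[OF I] intro!: product_map_in_tensors)
  next
    case zero
    have "precompose_slot A i 0 = (0 :: ('i \<Rightarrow> 'a) \<Rightarrow> 'b)"
      by (simp add: precompose_slot_def zero_fun_def)
    then show "precompose_slot A i (0 :: ('i \<Rightarrow> 'a) \<Rightarrow> 'b) \<in> tensors I" by (metis subspace_0 subspace_tensors)
  next
    case (add M M')
    then show "precompose_slot A i (M + M') \<in> tensors I"
      unfolding precompose_slot_linear by (intro subspace_add subspace_tensors)
  next
    case (scale c M)
    then show "precompose_slot A i (c *\<^sub>R M) \<in> tensors I"
      unfolding precompose_slot_linear by (intro subspace_scale subspace_tensors)
  qed
qed (simp_all add: precompose_slot_linear)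

lemma comp_linear_fun:
  assumes "linear A"
  shows "A \<circ> (M + M') = (A \<circ> M) + (A \<circ> M')" "A \<circ> (c *\<^sub>R M) = c *\<^sub>R (A \<circ> M)"
  by (auto simp: o_def plus_fun_def scaleR_fun_def linear_add[OF assms] linear_scale[OF assms])

lemma endomorphism_on_postcompose:
  fixes A :: "'b::real_vector \<Rightarrow> 'b"
  assumes A: "linear A"
  shows "endomorphism_on (tensors I :: (('i \<Rightarrow> 'a::real_vector) \<Rightarrow> 'b) set) ((\<circ>) A)"
proof (rule endomorphism_onI)
  fix M :: "('i \<Rightarrow> 'a) \<Rightarrow> 'b" assume "M \<in> tensors I"
  then show "A \<circ> M \<in> tensors I"
  proof (induction rule: tensors_induct)
    case (product l v)
    have "A \<circ> product_map I l v = product_map I l (A v)"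
      by (simp add: product_map_def o_def linear_scale[OF A])
    then show ?case using product by (auto intro!: product_map_in_tensors)
  next
    case zero
    have "A \<circ> 0 = (0 :: ('i \<Rightarrow> 'a) \<Rightarrow> 'b)" by (simp add: o_def zero_fun_def linear_0[OF A])
    then show "A \<circ> (0 :: ('i \<Rightarrow> 'a) \<Rightarrow> 'b) \<in> tensors I" by (metis subspace_0 subspace_tensors)
  next
    case (add M M')
    then show "A \<circ> (M + M') \<in> tensors I"
      unfolding comp_linear_fun[OF A] by (intro subspace_add subspace_tensors)
  next
    case (scale c M)
    then show "A \<circ> (c *\<^sub>R M) \<in> tensors I"
      unfolding comp_linear_fun[OF A] by (intro subspace_scale subspace_tensors)
  qed
qed (simp_all add: comp_linear_fun[OF A])

lemma endomorphism_on_derivation: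
  assumes "linear A" "finite I"
  shows "endomorphism_on (tensors I) (derivation I A)"
proof -
  have derivation_eq: "derivation I A = (\<lambda>M. (A \<circ> M) + - (\<Sum>i\<in>I. precompose_slot A i M))"
    by (rule ext) (simp add: derivation_def)
  show ?thesis
    unfolding derivation_eq
    by (rule endomorphism_on_add[OF subspace_tensors endomorphism_on_postcompose[OF assms(1)]
        endomorphism_on_uminus[OF subspace_tensors endomorphism_on_sum[OF subspace_tensors
            endomorphism_on_precompose_slot[OF assms]]]])
qed

lemma endomorphism_on_UNIV_iff: "endomorphism_on UNIV A \<longleftrightarrow> linear A"
  by (auto simp: endomorphism_on_def linear_iff)

subsection \<open>Polynomials in the slot operators\<close>

text \<open>
  Multilinearity is what moves the polynomial from the operator into the slot.
\<close>

lemma poly_op_precompose_slot: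
  fixes M :: "('i \<Rightarrow> 'a::real_vector) \<Rightarrow> 'b::real_vector"
  assumes A: "linear A" and I: "finite I" "i \<in> I" and M: "M \<in> tensors I"
  shows "poly_op p (precompose_slot A i) M x = M (x(i := poly_op p A (x i)))"
proof (induction p arbitrary: x)
  case 0
  show "poly_op 0 (precompose_slot A i) M x = M (x(i := poly_op 0 A (x i)))"
    using linear_0[OF tensors_linear_slot[OF M I, of x]] by simp
next
  case (pCons a p)
  note lin = tensors_linear_slot[OF M I, of x]
  have P0: "precompose_slot A i (0 :: ('i \<Rightarrow> 'a) \<Rightarrow> 'b) = 0" by (simp add: precompose_slot_def zero_fun_def)
  have comm: "poly_op p A (A e) = A (poly_op p A e)" for e
    using poly_op_commute_self[OF subspace_UNIV, of A] A by (simp add: endomorphism_on_UNIV_iff)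
  have "poly_op (pCons a p) (precompose_slot A i) M x
      = a *\<^sub>R M x + poly_op p (precompose_slot A i) M (x(i := A (x i)))"
    using poly_op_pCons[where T = "precompose_slot A i", OF P0]
    by (simp add: plus_fun_def scaleR_fun_def precompose_slot_def)
  also have "\<dots> = a *\<^sub>R M (x(i := x i)) + M (x(i := A (poly_op p A (x i))))"
    by (simp only: pCons.IH comm fun_upd_same fun_upd_upd fun_upd_triv)
  also have "\<dots> = M (x(i := a *\<^sub>R x i + A (poly_op p A (x i))))"
    by (simp only: linear_add[OF lin] linear_scale[OF lin])
  also have "a *\<^sub>R x i + A (poly_op p A (x i)) = poly_op (pCons a p) A (x i)"
    using poly_op_pCons[where T = A, OF linear_0[OF A]] by simp
  finally show "poly_op (pCons a p) (precompose_slot A i) M x = M (x(i := poly_op (pCons a p) A (x i)))" .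
qed

lemma poly_op_postcompose:
  fixes M :: "('i \<Rightarrow> 'a) \<Rightarrow> 'b::real_vector"
  assumes A: "linear A"
  shows "poly_op p ((\<circ>) A) M x = poly_op p A (M x)"
proof (induction p)
  case (pCons a p)
  have P0: "A \<circ> (0 :: ('i \<Rightarrow> 'a) \<Rightarrow> 'b) = 0" by (simp add: o_def zero_fun_def linear_0[OF A])
  have "poly_op (pCons a p) ((\<circ>) A) M = a *\<^sub>R M + (A \<circ> poly_op p ((\<circ>) A) M)"
    by (rule poly_op_pCons[where T = "(\<circ>) A", OF P0])
  then have "poly_op (pCons a p) ((\<circ>) A) M x = a *\<^sub>R M x + A (poly_op p ((\<circ>) A) M x)"
    by (simp add: plus_fun_def scaleR_fun_def)
  also have "\<dots> = poly_op (pCons a p) A (M x)"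
    by (simp only: pCons.IH poly_op_pCons[where T = A, OF linear_0[OF A]])
  finally show "poly_op (pCons a p) ((\<circ>) A) M x = poly_op (pCons a p) A (M x)" .
qed (simp add: zero_fun_def)

lemma separable_on_precompose_slot:
  assumes A: "separable_on UNIV A" and I: "finite I" "i \<in> I"
  shows "separable_on (tensors I :: (('i \<Rightarrow> 'a::real_vector) \<Rightarrow> 'b::real_vector) set) (precompose_slot A i)"
proof -
  have l: "linear A" using A by (simp add: separable_on_def endomorphism_on_UNIV_iff)
  obtain p where p: "separable_poly p" "\<And>x. poly_op p A x = 0"
    using A by (auto simp: separable_on_def)
  have "poly_op p (precompose_slot A i) M = 0" if "M \<in> tensors I" for M :: "('i \<Rightarrow> 'a) \<Rightarrow> 'b"
    using linear_0[OF tensors_linear_slot[OF that I]]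
    by (auto simp: fun_eq_iff poly_op_precompose_slot[OF l I that] p(2) zero_fun_def)
  then show ?thesis
    using endomorphism_on_precompose_slot[OF l I] p(1) unfolding separable_on_def by blast
qed

lemma separable_on_postcompose:
  fixes A :: "'b::real_vector \<Rightarrow> 'b"
  assumes A: "separable_on UNIV A"
  shows "separable_on (tensors I :: (('i \<Rightarrow> 'a::real_vector) \<Rightarrow> 'b) set) ((\<circ>) A)"
proof -
  have l: "linear A" using A by (simp add: separable_on_def endomorphism_on_UNIV_iff)
  obtain p where p: "separable_poly p" "\<And>x. poly_op p A x = 0"
    using A by (auto simp: separable_on_def)
  have "poly_op p ((\<circ>) A) M = 0" for M :: "('i \<Rightarrow> 'a) \<Rightarrow> 'b"
    by (rule ext) (simp only: poly_op_postcompose[OF l] p(2) zero_fun_apply)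
  then show ?thesis
    using endomorphism_on_postcompose[OF l] p(1) unfolding separable_on_def by blast
qed

lemma nilpotent_on_precompose_slot:
  assumes A: "linear A" "nilpotent_on UNIV A" and I: "finite I" "i \<in> I"
  shows "nilpotent_on (tensors I :: (('i \<Rightarrow> 'a::real_vector) \<Rightarrow> 'b::real_vector) set) (precompose_slot A i)"
proof -
  obtain m where m: "\<And>x. (A ^^ m) x = 0" using A(2) by (auto simp: nilpotent_on_def)
  have pow: "(precompose_slot A i ^^ k) M x = M (x(i := (A ^^ k) (x i)))"
    for k and M :: "('i \<Rightarrow> 'a) \<Rightarrow> 'b" and x
  proof (induction k arbitrary: x)
    case (Suc k)
    have "(precompose_slot A i ^^ Suc k) M x = (precompose_slot A i ^^ k) M (x(i := A (x i)))"
      by (simp only: funpow.simps o_apply precompose_slot_def)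
    also have "\<dots> = M (x(i := (A ^^ k) (A (x i))))"
      by (simp only: Suc.IH fun_upd_same fun_upd_upd)
    also have "(A ^^ k) (A (x i)) = (A ^^ Suc k) (x i)" by (simp add: funpow_swap1)
    finally show "(precompose_slot A i ^^ Suc k) M x = M (x(i := (A ^^ Suc k) (x i)))" .
  qed simp
  have "(precompose_slot A i ^^ m) M = 0" if "M \<in> tensors I" for M :: "('i \<Rightarrow> 'a) \<Rightarrow> 'b"
    using linear_0[OF tensors_linear_slot[OF that I]] by (auto simp: fun_eq_iff pow m zero_fun_def)
  then show ?thesis unfolding nilpotent_on_def by blast
qed

lemma nilpotent_on_postcompose:
  assumes A: "nilpotent_on UNIV A"
  shows "nilpotent_on (tensors I) ((\<circ>) A)"
proof -
  obtain m where m: "\<And>x. (A ^^ m) x = 0" using A by (auto simp: nilpotent_on_def)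
  have pow: "((\<circ>) A ^^ k) M x = (A ^^ k) (M x)" for k M x
    by (induction k) simp_all
  have "((\<circ>) A ^^ m) M = 0" for M by (auto simp: fun_eq_iff pow m zero_fun_def)
  then show ?thesis unfolding nilpotent_on_def by blast
qed

lemma commute_precompose_slots:
  assumes "\<And>x. A (B x) = B (A x)"
  shows "precompose_slot A i (precompose_slot B j M) = precompose_slot B j (precompose_slot A i M)"
  by (cases "i = j") (auto simp: precompose_slot_def assms fun_upd_twist)

lemma commute_precompose_postcompose:
  "precompose_slot A i (B \<circ> M) = B \<circ> precompose_slot A i M"
  by (simp add: precompose_slot_def o_def)

subsection \<open>Finite dimension\<close>

lemma sum_pointwise: "(\<Sum>a\<in>A. f a) x = (\<Sum>a\<in>A. f a x :: 'b::comm_monoid_add)"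
  by (induction A rule: infinite_finite_induct) auto

text \<open>
  Expand every linear form in the coordinate forms of a basis and multiply out the product.
\<close>

lemma finitely_spanned_tensors:
  fixes I :: "'i set"
  assumes "finite I" "finite_dimensional TYPE('a::real_vector)" "finite_dimensional TYPE('b::real_vector)"
  shows "finitely_spanned (tensors I :: (('i \<Rightarrow> 'a) \<Rightarrow> 'b) set)"
proof -
  have "finitely_spanned (UNIV :: 'a set)"
    using assms(2) by (auto simp: finite_dimensional_def finitely_spanned_def)
  then obtain C :: "'a set" where C: "finite C" "UNIV \<subseteq> span C" by (auto simp: finitely_spanned_def)
  obtain B :: "'a set" where "B \<subseteq> UNIV" and B: "independent B" "UNIV \<subseteq> span B"
    using maximal_independent_subset[of UNIV] .
  have fB: "finite B" using independent_span_bound[OF C(1) B(1)] C(2) by blast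
  obtain D :: "'b set" where D: "finite D" "span D = UNIV"
    using assms(3) by (auto simp: finite_dimensional_def)
  have expand: "l x = (\<Sum>b\<in>B. l b * representation B x b)" if "linear l" for l :: "'a \<Rightarrow> real" and x
  proof -
    have "x = (\<Sum>b\<in>B. representation B x b *\<^sub>R b)"
      using sum_representation_eq[OF B(1) _ fB order.refl, of x] B(2) by (metis UNIV_I subsetD)
    then have "l x = l (\<Sum>b\<in>B. representation B x b *\<^sub>R b)" by simp
    also have "\<dots> = (\<Sum>b\<in>B. l b * representation B x b)"
      by (simp add: linear_sum[OF that] linear_scale[OF that] mult.commute)
    finally show ?thesis .
  qed
  define m where "m g u = product_map I (\<lambda>i x. representation B x (g i)) u" for g :: "'i \<Rightarrow> 'a" and u :: 'b
  define S where "S = (\<lambda>(g, u). m g u) ` ((I \<rightarrow>\<^sub>E B) \<times> D)"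
  have fS: "finite S" using assms(1) fB D(1) by (auto simp: S_def intro!: finite_PiE)
  have mS: "m g v \<in> span S" if "g \<in> I \<rightarrow>\<^sub>E B" for g v
  proof -
    have lin: "linear (m g)"
      by (rule linearI)
        (auto simp: m_def product_map_def plus_fun_def scaleR_fun_def algebra_simps fun_eq_iff)
    have "v \<in> span D" using D(2) by simp
    then have "m g v \<in> span (m g ` D)" using linear_span_image[OF lin, of D] by blast
    moreover have "span (m g ` D) \<subseteq> span S" by (rule span_mono) (use that in \<open>auto simp: S_def\<close>)
    ultimately show ?thesis by blast
  qed
  have "product_map I l v \<in> span S" if l: "\<And>i. i \<in> I \<Longrightarrow> linear (l i)" for l and v :: 'b
  proof -
    have "product_map I l v x = (\<Sum>g\<in>I \<rightarrow>\<^sub>E B. (\<Prod>i\<in>I. l i (g i)) *\<^sub>R m g v) x" for x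
    proof -
      have "(\<Prod>i\<in>I. l i (x i)) = (\<Prod>i\<in>I. \<Sum>b\<in>B. l i b * representation B (x i) b)"
        using expand[OF l] by (intro prod.cong) auto
      also have "\<dots> = (\<Sum>g\<in>I \<rightarrow>\<^sub>E B. (\<Prod>i\<in>I. l i (g i)) * (\<Prod>i\<in>I. representation B (x i) (g i)))"
        using assms(1) fB by (simp add: prod_sum_PiE prod.distrib)
      finally show ?thesis
        by (simp add: product_map_def m_def scaleR_sum_left sum_pointwise scaleR_fun_def)
    qed
    then have "product_map I l v = (\<Sum>g\<in>I \<rightarrow>\<^sub>E B. (\<Prod>i\<in>I. l i (g i)) *\<^sub>R m g v)" by (rule ext)
    then show ?thesis by (simp only:) (intro span_sum span_scale mS)
  qed
  then have "tensors I \<subseteq> span S"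
    unfolding tensors_def by (intro span_minimal) auto
  then show ?thesis using fS unfolding finitely_spanned_def by blast
qed

subsection \<open>The SN-decomposition of a derivation\<close>

lemma derivation_add:
  assumes "finite I" "M \<in> tensors I"
  shows "derivation I (\<lambda>x. A x + B x) M = derivation I A M + derivation I B M"
proof -
  have "precompose_slot (\<lambda>x. A x + B x) i M = precompose_slot A i M + precompose_slot B i M"
    if "i \<in> I" for i
    by (rule ext) (simp add: precompose_slot_def plus_fun_def linear_add[OF tensors_linear_slot[OF assms(2,1) that]])
  then have "(\<Sum>i\<in>I. precompose_slot (\<lambda>x. A x + B x) i M)
      = (\<Sum>i\<in>I. precompose_slot A i M) + (\<Sum>i\<in>I. precompose_slot B i M)"
    by (simp add: sum.distrib)
  moreover have "(\<lambda>x. A x + B x) \<circ> M = (A \<circ> M) + (B \<circ> M)" by (simp add: o_def plus_fun_def)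
  ultimately show ?thesis by (simp only: derivation_def) simp
qed

lemma endomorphism_on_map_sum:
  assumes "subspace W" "endomorphism_on W \<pi>" "\<And>i. i \<in> I \<Longrightarrow> x i \<in> W"
  shows "\<pi> (\<Sum>i\<in>I. x i) = (\<Sum>i\<in>I. \<pi> (x i))"
  using assms(3)
proof (induction I rule: infinite_finite_induct)
  case (insert i I)
  then have "(\<Sum>i\<in>I. x i) \<in> W" by (auto intro!: subspace_sum[OF assms(1)])
  then show ?case using insert by (simp add: endomorphism_onD(2)[OF assms(2)])
qed (simp_all add: endomorphism_on_zero[OF assms(1,2)])

lemma commute_on_derivation:
  fixes A :: "'a::real_vector \<Rightarrow> 'a" and I :: "'i set"
  assumes A: "linear A" and I: "finite I" and \<pi>: "endomorphism_on (tensors I) \<pi>"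
    and comm: "commute_on (tensors I) ((\<circ>) A) \<pi>"
      "\<And>i. i \<in> I \<Longrightarrow> commute_on (tensors I) (precompose_slot A i) \<pi>"
  shows "commute_on (tensors I) (derivation I A) \<pi>"
  unfolding commute_on_def
proof
  fix M :: "('i \<Rightarrow> 'a) \<Rightarrow> 'a" assume M: "M \<in> tensors I"
  have slot: "precompose_slot A i M \<in> tensors I" if "i \<in> I" for i
    by (rule endomorphism_onD(1)[OF endomorphism_on_precompose_slot[OF A I that] M])
  then have sum: "(\<Sum>i\<in>I. precompose_slot A i M) \<in> tensors I" by (auto intro!: subspace_sum subspace_tensors)
  have "\<pi> (derivation I A M) = \<pi> (A \<circ> M) - \<pi> (\<Sum>i\<in>I. precompose_slot A i M)"
    using endomorphism_on_diff[OF subspace_tensors \<pi> endomorphism_onD(1)[OF endomorphism_on_postcompose[OF A] M] sum]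
    by (simp add: derivation_def)
  also have "\<pi> (\<Sum>i\<in>I. precompose_slot A i M) = (\<Sum>i\<in>I. precompose_slot A i (\<pi> M))"
    using endomorphism_on_map_sum[OF subspace_tensors \<pi> slot] commute_onD[OF comm(2) M] by simp
  also have "\<pi> (A \<circ> M) = A \<circ> \<pi> M" using commute_onD[OF comm(1) M] by simp
  finally show "derivation I A (\<pi> M) = \<pi> (derivation I A M)"
    by (simp only: derivation_def diff_conv_add_uminus)
qed

text \<open>
  Every summand of the first derivation commutes with every summand of the second.
\<close>

lemma commute_on_derivations:
  assumes A: "linear A" and B: "linear B" and I: "finite I" and AB: "\<And>x. A (B x) = B (A x)"
  shows "commute_on (tensors I) (derivation I A) (derivation I B)"
proof (rule commute_on_derivation[OF A I endomorphism_on_derivation[OF B I]])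
  show "commute_on (tensors I) ((\<circ>) A) (derivation I B)"
  proof (subst commute_on_sym, rule commute_on_derivation[OF B I endomorphism_on_postcompose[OF A]])
    show "commute_on (tensors I) ((\<circ>) B) ((\<circ>) A)" by (simp add: commute_on_def fun_eq_iff AB)
  qed (simp add: commute_on_def commute_precompose_postcompose)
  fix i assume i: "i \<in> I"
  show "commute_on (tensors I) (precompose_slot A i) (derivation I B)"
  proof (subst commute_on_sym, rule commute_on_derivation[OF B I endomorphism_on_precompose_slot[OF A I i]])
    show "commute_on (tensors I) (precompose_slot B j) (precompose_slot A i)" for j
      unfolding commute_on_def by (intro ballI commute_precompose_slots) (simp add: AB)
  qed (simp add: commute_on_def commute_precompose_postcompose)
qed

lemma separable_on_derivation:
  fixes A :: "'a::real_vector \<Rightarrow> 'a"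
  assumes "finite_dimensional TYPE('a)" and A: "separable_on UNIV A" and I: "finite I"
  shows "separable_on (tensors I) (derivation I A)"
proof -
  have l: "linear A" using A by (simp add: separable_on_def endomorphism_on_UNIV_iff)
  let ?F = "insert ((\<circ>) A) (precompose_slot A ` I)"
  show ?thesis
  proof (rule separable_on_commuting_family[OF subspace_tensors finitely_spanned_tensors[OF I assms(1,1)]])
    show "finite ?F" using I by simp
    show "separable_on (tensors I) S" if "S \<in> ?F" for S
      using that separable_on_postcompose[OF A] separable_on_precompose_slot[OF A I] by auto
    show "commute_on (tensors I) S T" if "S \<in> ?F" "T \<in> ?F" for S T
      using that by (auto simp: commute_on_def commute_precompose_postcompose intro: commute_precompose_slots)
    show "endomorphism_on (tensors I) (derivation I A)" by (rule endomorphism_on_derivation[OF l I])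
    show "commute_on (tensors I) (derivation I A) \<pi>"
      if "endomorphism_on (tensors I) \<pi>" "\<And>S. S \<in> ?F \<Longrightarrow> commute_on (tensors I) S \<pi>" for \<pi>
      using that by (intro commute_on_derivation[OF l I]) auto
  qed
qed

lemma nilpotent_on_derivation:
  assumes A: "linear A" "nilpotent_on UNIV A" and I: "finite I"
  shows "nilpotent_on (tensors I) (derivation I A)"
proof -
  let ?s = "\<lambda>M. \<Sum>i\<in>I. precompose_slot A i M"
  have e: "endomorphism_on (tensors I) (precompose_slot A i)" if "i \<in> I" for i
    by (rule endomorphism_on_precompose_slot[OF A(1) I that])
  have es: "endomorphism_on (tensors I) ?s" by (rule endomorphism_on_sum[OF subspace_tensors e])
  have "nilpotent_on (tensors I) ?s"
    by (rule nilpotent_on_sum[OF subspace_tensors I e])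
      (auto simp: commute_on_def nilpotent_on_precompose_slot[OF A I] intro: commute_precompose_slots)
  then have nil: "nilpotent_on (tensors I) (\<lambda>M. - ?s M)" by (rule nilpotent_on_uminus[OF es])
  have "A \<circ> ?s M = ?s (A \<circ> M)" if M: "M \<in> tensors I" for M
    using endomorphism_on_map_sum[OF subspace_tensors endomorphism_on_postcompose[OF A(1)] endomorphism_onD(1)[OF e M]]
    by (simp add: commute_precompose_postcompose)
  then have "commute_on (tensors I) ((\<circ>) A) (\<lambda>M. - ?s M)"
    using endomorphism_on_minus[OF endomorphism_on_postcompose[OF A(1)] endomorphism_onD(1)[OF es]]
    by (simp add: commute_on_def)
  then have "nilpotent_on (tensors I) (\<lambda>M. (A \<circ> M) + - ?s M)"
    by (rule nilpotent_on_add[OF subspace_tensors endomorphism_on_postcompose[OF A(1)]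
          endomorphism_on_uminus[OF subspace_tensors es] _ nilpotent_on_postcompose[OF A(2)] nil])
  moreover have "derivation I A = (\<lambda>M. (A \<circ> M) + - ?s M)" by (rule ext) (simp add: derivation_def)
  ultimately show ?thesis by simp
qed

lemma SN_decomposition_derivation:
  fixes A :: "'a::real_vector \<Rightarrow> 'a"
  assumes fd: "finite_dimensional TYPE('a)" and SN: "SN_decomposition UNIV A S N" and I: "finite I"
  shows "SN_decomposition (tensors I) (derivation I A) (derivation I S) (derivation I N)"
proof -
  have "finitely_spanned (UNIV :: 'a set)"
    using fd by (auto simp: finite_dimensional_def finitely_spanned_def)
  note D = SN_decompositionD[OF subspace_UNIV this SN]
  have l: "linear S" "linear N" using D(2,3) by (simp_all add: endomorphism_on_UNIV_iff)
  have A: "A = (\<lambda>x. S x + N x)" using D(5) by auto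
  show ?thesis
  proof (rule SN_decompositionI[OF subspace_tensors])
    show "derivation I A M = derivation I S M + derivation I N M" if "M \<in> tensors I" for M
      unfolding A by (rule derivation_add[OF I that])
    show "commute_on (tensors I) (derivation I S) (derivation I N)"
      using D(6) by (intro commute_on_derivations l I) (simp add: commute_on_def)
  qed (use D l I fd in \<open>auto intro: separable_on_derivation endomorphism_on_derivation nilpotent_on_derivation\<close>)
qed

section \<open>Homogeneous polynomial maps\<close>

definition diagonal :: "(('i \<Rightarrow> 'a) \<Rightarrow> 'b) \<Rightarrow> 'a \<Rightarrow> 'b"
  where "diagonal M = (\<lambda>x. M (\<lambda>_. x))"

lemma linear_diagonal: "linear (diagonal :: (('i \<Rightarrow> 'a) \<Rightarrow> 'b::real_vector) \<Rightarrow> 'a \<Rightarrow> 'b)"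
  by (rule linearI) (simp_all add: diagonal_def plus_fun_def scaleR_fun_def)

lemma homogeneous_polynomial_maps_eq_diagonal:
  "homogeneous_polynomial_maps d = diagonal ` tensors {..<d}"
proof -
  have "{\<lambda>x. (\<Prod>i<d. l i x) *\<^sub>R v | (l :: nat \<Rightarrow> 'a \<Rightarrow> real) (v :: 'b). \<forall>i<d. linear (l i)}
      = diagonal ` {product_map {..<d} l v | l v. \<forall>i\<in>{..<d}. linear (l i)}"
    (is "?G = diagonal ` ?T")
  proof (intro equalityI subsetI)
    fix g assume "g \<in> ?G"
    then obtain l v where "g = (\<lambda>x. (\<Prod>i<d. l i x) *\<^sub>R v)" "\<forall>i<d. linear (l i)" by blast
    then have "g = diagonal (product_map {..<d} l v)" "product_map {..<d} l v \<in> ?T"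
      by (auto simp: diagonal_def product_map_def)
    then show "g \<in> diagonal ` ?T" by blast
  next
    fix g assume "g \<in> diagonal ` ?T"
    then obtain l v where "g = diagonal (product_map {..<d} l v)" "\<forall>i\<in>{..<d}. linear (l i)" by blast
    then have "g = (\<lambda>x. (\<Prod>i<d. l i x) *\<^sub>R v)" "\<forall>i<d. linear (l i)"
      by (auto simp: diagonal_def product_map_def)
    then show "g \<in> ?G" by blast
  qed
  then show ?thesis
    unfolding homogeneous_polynomial_maps_def tensors_def by (simp only: linear_span_image[OF linear_diagonal])
qed

lemma subspace_homogeneous_polynomial_maps: "subspace (homogeneous_polynomial_maps d)"
  by (simp add: homogeneous_polynomial_maps_def)

lemma finitely_spanned_homogeneous_polynomial_maps:
  assumes "finite_dimensional TYPE('a::real_vector)" "finite_dimensional TYPE('b::real_vector)"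
  shows "finitely_spanned (homogeneous_polynomial_maps d :: ('a \<Rightarrow> 'b) set)"
  unfolding homogeneous_polynomial_maps_eq_diagonal
  by (rule finitely_spanned_linear_image[OF finitely_spanned_tensors[OF finite_lessThan assms] linear_diagonal])

lemma homogeneous_polynomial_maps_precompose:
  fixes L :: "'c::real_vector \<Rightarrow> 'a::real_vector" and g :: "'a \<Rightarrow> 'b::real_vector"
  assumes L: "linear L" and g: "g \<in> homogeneous_polynomial_maps d"
  shows "(\<lambda>x. g (L x)) \<in> homogeneous_polynomial_maps d"
proof -
  have lin: "linear (\<lambda>(g :: 'a \<Rightarrow> 'b) x. g (L x))"
    by (rule linearI) (simp_all add: plus_fun_def scaleR_fun_def)
  let ?G = "{\<lambda>x. (\<Prod>i<d. l i x) *\<^sub>R v | (l :: nat \<Rightarrow> 'a \<Rightarrow> real) (v :: 'b). \<forall>i<d. linear (l i)}"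
  have "(\<lambda>x. g (L x)) \<in> span ((\<lambda>g x. g (L x)) ` ?G)"
    using g linear_span_image[OF lin, of ?G] unfolding homogeneous_polynomial_maps_def by blast
  moreover have "(\<lambda>g x. g (L x)) ` ?G \<subseteq> homogeneous_polynomial_maps d"
  proof (rule image_subsetI)
    fix g assume "g \<in> ?G"
    then obtain l v where g: "g = (\<lambda>x. (\<Prod>i<d. l i x) *\<^sub>R v)" and l: "\<forall>i<d. linear (l i)" by blast
    have "\<forall>i<d. linear (\<lambda>x. l i (L x))" using l linear_compose[OF L, unfolded o_def] by blast
    then show "(\<lambda>x. g (L x)) \<in> homogeneous_polynomial_maps d"
      unfolding homogeneous_polynomial_maps_def g
      by (intro span_base CollectI exI[of _ "\<lambda>i x. l i (L x)"] exI[of _ v]) simp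
  qed
  ultimately show ?thesis
    using span_minimal[OF _ subspace_homogeneous_polynomial_maps] by blast
qed

lemma homogeneous_polynomial_maps_postcompose:
  fixes A :: "'b::real_vector \<Rightarrow> 'c::real_vector" and g :: "'a::real_vector \<Rightarrow> 'b"
  assumes A: "linear A" and g: "g \<in> homogeneous_polynomial_maps d"
  shows "(\<lambda>x. A (g x)) \<in> homogeneous_polynomial_maps d"
proof -
  have lin: "linear (\<lambda>(g :: 'a \<Rightarrow> 'b) x. A (g x))"
    by (rule linearI) (simp_all add: plus_fun_def scaleR_fun_def linear_add[OF A] linear_scale[OF A])
  let ?G = "{\<lambda>x. (\<Prod>i<d. l i x) *\<^sub>R v | (l :: nat \<Rightarrow> 'a \<Rightarrow> real) (v :: 'b). \<forall>i<d. linear (l i)}"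
  have "(\<lambda>x. A (g x)) \<in> span ((\<lambda>g x. A (g x)) ` ?G)"
    using g linear_span_image[OF lin, of ?G] unfolding homogeneous_polynomial_maps_def by blast
  moreover have "(\<lambda>g x. A (g x)) ` ?G \<subseteq> homogeneous_polynomial_maps d"
  proof (rule image_subsetI)
    fix g assume "g \<in> ?G"
    then obtain l v where g: "g = (\<lambda>x. (\<Prod>i<d. l i x) *\<^sub>R v)" and l: "\<forall>i<d. linear (l i)" by blast
    then show "(\<lambda>x. A (g x)) \<in> homogeneous_polynomial_maps d"
      unfolding homogeneous_polynomial_maps_def g linear_scale[OF A]
      by (intro span_base CollectI exI[of _ l] exI[of _ "A v"]) simp
  qed
  ultimately show ?thesis
    using span_minimal[OF _ subspace_homogeneous_polynomial_maps] by blast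
qed

subsection \<open>Derivatives\<close>

text \<open>
  The product rule: differentiate one slot at a time.
\<close>

lemma has_derivative_diagonal:
  fixes M :: "('i \<Rightarrow> 'a::real_normed_vector) \<Rightarrow> 'b::real_normed_vector"
  assumes fd: "finite_dimensional TYPE('a)" and I: "finite I" and M: "M \<in> tensors I"
  shows "(diagonal M has_derivative (\<lambda>h. \<Sum>i\<in>I. M ((\<lambda>_. x)(i := h)))) (at x)"
  using M
proof (induction rule: tensors_induct)
  case (product l v)
  have l: "(l i has_derivative l i) (at x)" if "i \<in> I" for i
    by (rule bounded_linear_imp_has_derivative[OF bounded_linear_finite_dimensional[OF fd product[OF that]]])
  have "((\<lambda>x. (\<Prod>i\<in>I. l i x) *\<^sub>R v) has_derivative
      (\<lambda>h. (\<Sum>i\<in>I. l i h * (\<Prod>j\<in>I - {i}. l j x)) *\<^sub>R v)) (at x)"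
    by (intro has_derivative_scaleR_left has_derivative_prod l)
  moreover have "(\<Sum>i\<in>I. l i h * (\<Prod>j\<in>I - {i}. l j x)) *\<^sub>R v
      = (\<Sum>i\<in>I. product_map I l v ((\<lambda>_. x)(i := h)))" for h
    unfolding scaleR_sum_left by (rule sum.cong) (simp_all only: product_map_update[OF I] scaleR_scaleR)
  ultimately show "(diagonal (product_map I l v) has_derivative
      (\<lambda>h. \<Sum>i\<in>I. product_map I l v ((\<lambda>_. x)(i := h)))) (at x)"
    by (simp only: diagonal_def product_map_def)
next
  case zero
  show "(diagonal 0 has_derivative (\<lambda>h. \<Sum>i\<in>I. (0 :: _ \<Rightarrow> 'b) ((\<lambda>_. x)(i := h)))) (at x)"
    by (simp add: diagonal_def)
next
  case (add M M')
  from has_derivative_add[OF add.IH]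
  show "(diagonal (M + M') has_derivative (\<lambda>h. \<Sum>i\<in>I. (M + M') ((\<lambda>_. x)(i := h)))) (at x)"
    by (simp only: diagonal_def plus_fun_apply sum.distrib)
next
  case (scale c M)
  from has_derivative_scaleR_right[OF scale.IH, of c]
  show "(diagonal (c *\<^sub>R M) has_derivative (\<lambda>h. \<Sum>i\<in>I. (c *\<^sub>R M) ((\<lambda>_. x)(i := h)))) (at x)"
    by (simp only: diagonal_def scaleR_fun_def scaleR_sum_right)
qed

lemma frechet_derivative_eqI: "(f has_derivative f') (at x) \<Longrightarrow> frechet_derivative f (at x) = f'"
  using frechet_derivative_at by metis

text \<open>
  Polynomial maps of all degrees, a class closed under directional derivatives. Indexing the factors
  by a set lets the product rule remove a factor without renumbering the others.
\<close>

definition polynomial_maps :: "('a::real_vector \<Rightarrow> 'b::real_vector) set"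
  where "polynomial_maps =
    span {diagonal (product_map I l v) | (I :: nat set) l v. finite I \<and> (\<forall>i\<in>I. linear (l i))}"

lemma homogeneous_subset_polynomial_maps: "homogeneous_polynomial_maps d \<subseteq> polynomial_maps"
  unfolding homogeneous_polynomial_maps_def polynomial_maps_def
proof (rule span_mono, rule subsetI)
  fix g assume "g \<in> {\<lambda>x. (\<Prod>i<d. l i x) *\<^sub>R v | (l :: nat \<Rightarrow> 'a \<Rightarrow> real) (v :: 'b). \<forall>i<d. linear (l i)}"
  then obtain l v where "g = (\<lambda>x. (\<Prod>i<d. l i x) *\<^sub>R v)" "\<forall>i<d. linear (l i)" by blast
  then have "g = diagonal (product_map {..<d} l v)" "\<forall>i\<in>{..<d}. linear (l i)"
    by (auto simp: diagonal_def product_map_def)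
  then show "g \<in> {diagonal (product_map I l v) | (I :: nat set) l v. finite I \<and> (\<forall>i\<in>I. linear (l i))}"
    by blast
qed

lemma polynomial_maps_derivative:
  fixes f :: "'a::real_normed_vector \<Rightarrow> 'b::real_normed_vector"
  assumes fd: "finite_dimensional TYPE('a)" and f: "f \<in> polynomial_maps"
  shows "\<exists>f'. (\<forall>x. (f has_derivative f' x) (at x)) \<and> (\<forall>h. (\<lambda>x. f' x h) \<in> polynomial_maps)"
  using f unfolding polynomial_maps_def
proof (induction rule: span_induct_alt)
  case base
  have "((0 :: 'a \<Rightarrow> 'b) has_derivative (\<lambda>h. 0)) (at x)" for x
    by (simp add: zero_fun_def)
  moreover have "(0 :: 'a \<Rightarrow> 'b) \<in> polynomial_maps"
    unfolding polynomial_maps_def by (rule span_zero)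
  then have "(\<lambda>x. 0) \<in> (polynomial_maps :: ('a \<Rightarrow> 'b) set)" by (simp only: zero_fun_def)
  ultimately show "\<exists>f'. (\<forall>x. ((0 :: 'a \<Rightarrow> 'b) has_derivative f' x) (at x)) \<and>
      (\<forall>h. (\<lambda>x. f' x h) \<in> span {diagonal (product_map I l v) | (I :: nat set) l v. finite I \<and> (\<forall>i\<in>I. linear (l i))})"
    unfolding polynomial_maps_def by (intro exI[of _ "\<lambda>x h. 0"]) simp
next
  case (step c g f)
  obtain f' where f': "\<And>x. (f has_derivative f' x) (at x)" "\<And>h. (\<lambda>x. f' x h) \<in> polynomial_maps"
    using step.IH unfolding polynomial_maps_def by blast
  obtain I :: "nat set" and l v where g: "g = diagonal (product_map I l v)"
    and I: "finite I" and l: "\<And>i. i \<in> I \<Longrightarrow> linear (l i)" using step.hyps by blast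
  let ?g' = "\<lambda>x h. \<Sum>i\<in>I. product_map I l v ((\<lambda>_. x)(i := h))"
  have g': "(g has_derivative ?g' x) (at x)" for x
    unfolding g by (rule has_derivative_diagonal[OF fd I product_map_in_tensors[OF l]])
  have "(\<lambda>x. ?g' x h) \<in> polynomial_maps" for h
  proof -
    have "(\<lambda>x. ?g' x h) = (\<Sum>i\<in>I. diagonal (product_map (I - {i}) l (l i h *\<^sub>R v)))"
    proof (rule ext)
      fix x
      show "?g' x h = (\<Sum>i\<in>I. diagonal (product_map (I - {i}) l (l i h *\<^sub>R v))) x"
        unfolding sum_pointwise
        by (rule sum.cong) (simp_all only: product_map_update[OF I], simp add: diagonal_def product_map_def)
    qed
    moreover have "diagonal (product_map (I - {i}) l (l i h *\<^sub>R v)) \<in> polynomial_maps" for i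
      unfolding polynomial_maps_def using I l by (intro span_base) blast
    ultimately show ?thesis
      unfolding polynomial_maps_def by (simp only: span_sum)
  qed
  then have "(\<lambda>x. c *\<^sub>R ?g' x h + f' x h) \<in> polynomial_maps" for h
    using span_add[OF span_scale f'(2)[unfolded polynomial_maps_def], of _ c h]
    unfolding polynomial_maps_def by (simp only: plus_fun_def scaleR_fun_def)
  moreover have "((c *\<^sub>R g + f) has_derivative (\<lambda>h. c *\<^sub>R ?g' x h + f' x h)) (at x)" for x
    using has_derivative_add[OF has_derivative_scaleR_right[OF g'] f'(1)]
    by (simp only: plus_fun_def scaleR_fun_def)
  ultimately show "\<exists>f'. (\<forall>x. ((c *\<^sub>R g + f) has_derivative f' x) (at x)) \<and>
      (\<forall>h. (\<lambda>x. f' x h) \<in> span {diagonal (product_map I l v) | (I :: nat set) l v. finite I \<and> (\<forall>i\<in>I. linear (l i))})"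
    unfolding polynomial_maps_def by (intro exI[of _ "\<lambda>x h. c *\<^sub>R ?g' x h + f' x h"]) simp
qed

lemma polynomial_maps_smooth:
  fixes f :: "'a::real_normed_vector \<Rightarrow> 'b::real_normed_vector"
  assumes fd: "finite_dimensional TYPE('a)" and f: "f \<in> polynomial_maps"
  shows "f \<in> smooth_maps"
proof -
  have "times_differentiable r f" for r
    using f
  proof (induction r arbitrary: f)
    case 0
    then obtain f' where "\<And>x. (f has_derivative f' x) (at x)"
      using polynomial_maps_derivative[OF fd] by blast
    then show ?case
      by (auto simp: continuous_on_eq_continuous_at intro: has_derivative_continuous)
  next
    case (Suc r)
    then obtain f' where f': "\<And>x. (f has_derivative f' x) (at x)" "\<And>h. (\<lambda>x. f' x h) \<in> polynomial_maps"
      using polynomial_maps_derivative[OF fd] by metis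
    have "times_differentiable r (\<lambda>x. frechet_derivative f (at x) v)" for v
      using Suc.IH[OF f'(2)] by (simp only: frechet_derivative_eqI[OF f'(1)])
    then show ?case using f'(1) unfolding times_differentiable.simps differentiable_def by blast
  qed
  then show ?thesis by (simp add: smooth_maps_def)
qed

lemma homogeneous_polynomial_maps_has_derivative:
  fixes g :: "'a::real_normed_vector \<Rightarrow> 'b::real_normed_vector"
  assumes "finite_dimensional TYPE('a)" "g \<in> homogeneous_polynomial_maps d"
  shows "(g has_derivative frechet_derivative g (at x)) (at x)"
  using polynomial_maps_derivative[OF assms(1)] assms(2) homogeneous_subset_polynomial_maps
    frechet_derivative_eqI by (metis subsetD)

lemma homogeneous_polynomial_maps_derivative:
  fixes g :: "'a::real_normed_vector \<Rightarrow> 'b::real_normed_vector"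
  assumes fd: "finite_dimensional TYPE('a)" and L: "linear L" and g: "g \<in> homogeneous_polynomial_maps d"
  shows "(\<lambda>x. frechet_derivative g (at x) (L x)) \<in> homogeneous_polynomial_maps d"
proof -
  obtain M where M: "M \<in> tensors {..<d}" "g = diagonal M"
    using g by (auto simp: homogeneous_polynomial_maps_eq_diagonal)
  have "(\<lambda>x. frechet_derivative g (at x) (L x)) = diagonal (\<Sum>i<d. precompose_slot L i M)"
    using frechet_derivative_eqI[OF has_derivative_diagonal[OF fd finite_lessThan M(1)]]
    by (auto simp: M(2) diagonal_def sum_pointwise precompose_slot_def)
  moreover have "(\<Sum>i<d. precompose_slot L i M) \<in> tensors {..<d}"
    using endomorphism_onD(1)[OF endomorphism_on_precompose_slot[OF L finite_lessThan] M(1)]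
    by (intro subspace_sum subspace_tensors) auto
  ultimately show ?thesis unfolding homogeneous_polynomial_maps_eq_diagonal by blast
qed

subsection \<open>The Lie bracket with a linear vector field\<close>

text \<open>
  The Lie bracket of the linear vector field \<open>A\<close>, which is its own derivative, with \<open>G\<close>.
\<close>

definition linear_bracket :: "('a::real_normed_vector \<Rightarrow> 'a) \<Rightarrow> ('a \<Rightarrow> 'a) \<Rightarrow> 'a \<Rightarrow> 'a"
  where "linear_bracket A G = (\<lambda>x. A (G x) - frechet_derivative G (at x) (A x))"

lemma linear_bracket_diagonal:
  fixes M :: "('i \<Rightarrow> 'a::real_normed_vector) \<Rightarrow> 'a"
  assumes "finite_dimensional TYPE('a)" "finite I" "M \<in> tensors I"
  shows "diagonal (derivation I A M) = linear_bracket A (diagonal M)"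
  using frechet_derivative_eqI[OF has_derivative_diagonal[OF assms]]
  by (auto simp: linear_bracket_def diagonal_def derivation_def sum_pointwise precompose_slot_def)

text \<open>
  The decomposition of the derivation on multilinear maps is pushed forward along the restriction to
  the diagonal, whose image is the space of homogeneous polynomial maps.
\<close>

lemma SN_decomposition_linear_bracket:
  fixes A :: "'a::real_normed_vector \<Rightarrow> 'a"
  assumes fd: "finite_dimensional TYPE('a)" and SN: "SN_decomposition UNIV A S N"
  shows "SN_decomposition (homogeneous_polynomial_maps d)
    (linear_bracket A) (linear_bracket S) (linear_bracket N)"
  unfolding homogeneous_polynomial_maps_eq_diagonal
  by (rule SN_decomposition_image[OF subspace_tensors finitely_spanned_tensors[OF finite_lessThan fd fd]
        linear_diagonal SN_decomposition_derivation[OF fd SN finite_lessThan]])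
    (rule linear_bracket_diagonal[OF fd finite_lessThan], assumption)+

section \<open>The network bracket and the Lie bracket\<close>

text \<open>
  The network on \<open>V^n\<close> in which the semigroup acts on itself. With it the sum over partial derivatives in
  the bracket becomes one total derivative, see \<open>ad_eq\<close>.
\<close>

definition regular_network ::
    "('n::finite \<Rightarrow> 'N \<Rightarrow> 'N) \<Rightarrow> ('v ^ 'n \<Rightarrow> 'v) \<Rightarrow> 'v ^ 'n \<Rightarrow> 'v ^ 'n"
  where "regular_network \<sigma> f X = (\<chi> j. f (A_map \<sigma> j X))"

definition cell_input :: "('n::finite \<Rightarrow> 'N::finite \<Rightarrow> 'N) \<Rightarrow> 'N \<Rightarrow> 'v ^ 'N \<Rightarrow> 'v ^ 'n"
  where "cell_input \<sigma> i x = (\<chi> j. x $ \<sigma> j i)"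

lemma gamma_eq_cell_input: "gamma \<sigma> f x = (\<chi> i. f (cell_input \<sigma> i x))"
  by (simp add: gamma_def cell_input_def)

lemma linear_A_map: "linear (A_map \<sigma> j :: 'v::real_vector ^ 'n \<Rightarrow> 'v ^ 'n::finite)"
  by (intro linearI) (auto simp: A_map_def vec_eq_iff)

lemma linear_cell_input: "linear (cell_input \<sigma> i :: 'v::real_vector ^ 'N::finite \<Rightarrow> 'v ^ 'n::finite)"
  by (intro linearI) (auto simp: cell_input_def vec_eq_iff)

lemma linear_regular_network: "linear f \<Longrightarrow> linear (regular_network \<sigma> f)"
  by (rule linearI)
    (simp_all add: regular_network_def vec_eq_iff linear_add[OF linear_A_map] linear_scale[OF linear_A_map]
      linear_add linear_scale)

lemma linear_gamma_apply: "linear f \<Longrightarrow> linear (gamma \<sigma> f)"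
  by (rule linearI)
    (simp_all add: gamma_eq_cell_input vec_eq_iff linear_add[OF linear_cell_input]
      linear_scale[OF linear_cell_input] linear_add linear_scale)

lemma linear_gamma: "linear (gamma \<sigma> :: ('v::real_vector ^ 'n::finite \<Rightarrow> 'v) \<Rightarrow> 'v ^ 'N::finite \<Rightarrow> 'v ^ 'N)"
  by (rule linearI) (auto simp: gamma_def fun_eq_iff vec_eq_iff scaleR_fun_def)

lemma homogeneous_polynomial_maps_vec:
  fixes g :: "'i::finite \<Rightarrow> 'a::real_vector \<Rightarrow> 'b::real_vector"
  assumes "\<And>i. g i \<in> homogeneous_polynomial_maps d"
  shows "(\<lambda>x. \<chi> i. g i x) \<in> homogeneous_polynomial_maps d"
proof -
  have "(\<lambda>x. \<chi> i. g i x) = (\<Sum>i\<in>UNIV. (\<lambda>x. axis i (g i x)))"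
  proof (rule ext)
    fix x
    show "(\<chi> i. g i x) = (\<Sum>i\<in>UNIV. (\<lambda>x. axis i (g i x))) x"
      unfolding sum_pointwise using vec_eq_sum_axis[of "\<chi> i. g i x"] by simp
  qed
  also have "\<dots> \<in> homogeneous_polynomial_maps d"
    by (rule subspace_sum[OF subspace_homogeneous_polynomial_maps])
      (rule homogeneous_polynomial_maps_postcompose[OF linear_axis assms])
  finally show ?thesis .
qed

lemma gamma_homogeneous:
  fixes g :: "'v::real_vector ^ 'n::finite \<Rightarrow> 'v" and \<sigma> :: "'n \<Rightarrow> 'N::finite \<Rightarrow> 'N"
  assumes "g \<in> homogeneous_polynomial_maps d"
  shows "gamma \<sigma> g \<in> homogeneous_polynomial_maps d"
proof -
  have "gamma \<sigma> g = (\<lambda>x. \<chi> i. g (cell_input \<sigma> i x))" by (rule ext) (rule gamma_eq_cell_input)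
  then show ?thesis
    using homogeneous_polynomial_maps_vec[where g = "\<lambda>i x. g (cell_input \<sigma> i x)",
        OF homogeneous_polynomial_maps_precompose[OF linear_cell_input assms]] by (simp only:)
qed

lemma regular_network_homogeneous:
  fixes g :: "'v::real_vector ^ 'n::finite \<Rightarrow> 'v"
  assumes "g \<in> homogeneous_polynomial_maps d"
  shows "regular_network \<sigma> g \<in> homogeneous_polynomial_maps d"
  unfolding regular_network_def[abs_def]
  by (rule homogeneous_polynomial_maps_vec[where g = "\<lambda>j X. g (A_map \<sigma> j X)",
        OF homogeneous_polynomial_maps_precompose[OF linear_A_map assms]])

text \<open>
  Replacing the \<open>j\<close>-th entry of \<open>X\<close> by \<open>v\<close> is the affine map \<open>v \<mapsto> X + axis j (v - X $ j)\<close>.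
\<close>

lemma partial_deriv_eq_frechet_derivative:
  fixes f :: "'v::real_normed_vector ^ 'n::finite \<Rightarrow> 'v"
  assumes fd: "finite_dimensional TYPE('v)" and f: "(f has_derivative f') (at X)"
  shows "partial_deriv j f X v = f' (axis j v)"
proof -
  let ?u = "\<lambda>v. X + axis j (v - X $ j)"
  have u: "(\<chi> l. if l = j then v else X $ l) = ?u v" for v
    by (simp add: vec_eq_iff axis_def)
  have ax: "bounded_linear (axis j :: 'v \<Rightarrow> 'v ^ 'n)"
    by (rule bounded_linear_finite_dimensional[OF fd linear_axis])
  have "((\<lambda>v. v - X $ j) has_derivative (\<lambda>v. v)) (at (X $ j))"
    by (auto intro!: derivative_eq_intros)
  then have "(?u has_derivative (\<lambda>v. axis j v)) (at (X $ j))"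
    using has_derivative_add[OF has_derivative_const bounded_linear.has_derivative[OF ax], of "\<lambda>v. v - X $ j" "\<lambda>v. v" "at (X $ j)" X]
    by simp
  moreover have "?u (X $ j) = X" by (simp add: vec_eq_iff axis_def)
  then have "(f has_derivative f') (at (?u (X $ j)))" using f by (simp only:)
  ultimately have "((\<lambda>v. f (?u v)) has_derivative (\<lambda>v. f' (axis j v))) (at (X $ j))"
    by (rule has_derivative_compose)
  then show ?thesis
    unfolding partial_deriv_def u by (simp only: frechet_derivative_eqI)
qed

lemma ad_eq:
  fixes f g :: "'v::real_normed_vector ^ 'n::finite \<Rightarrow> 'v" and \<sigma> :: "'n \<Rightarrow> 'N::finite \<Rightarrow> 'N"
  assumes fd: "finite_dimensional TYPE('v)" and f: "linear f"
    and g: "g \<in> homogeneous_polynomial_maps d"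
  shows "ad \<sigma> f g = (\<lambda>X. f (regular_network \<sigma> g X)
    - frechet_derivative g (at X) (regular_network \<sigma> f X))"
proof
  fix X
  have fdn: "finite_dimensional TYPE('v ^ 'n)" by (rule finite_dimensional_vec[OF fd])
  have Df: "(f has_derivative f) (at X)"
    by (rule bounded_linear_imp_has_derivative[OF bounded_linear_finite_dimensional[OF fdn f]])
  let ?Dg = "frechet_derivative g (at X)"
  have Dg: "(g has_derivative ?Dg) (at X)"
    by (rule homogeneous_polynomial_maps_has_derivative[OF fdn g])
  have lin: "linear ?Dg" using Dg has_derivative_linear by blast
  have sum: "h (regular_network \<sigma> k X) = (\<Sum>j\<in>UNIV. h (axis j (k (A_map \<sigma> j X))))"
    if "linear h" for h k :: "'v ^ 'n \<Rightarrow> 'v"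
    by (subst vec_eq_sum_axis) (simp add: linear_sum[OF that] regular_network_def)
  show "ad \<sigma> f g X = f (regular_network \<sigma> g X) - ?Dg (regular_network \<sigma> f X)"
    by (simp add: ad_def sum_subtractf sum[OF f] sum[OF lin]
        partial_deriv_eq_frechet_derivative[OF fd Df] partial_deriv_eq_frechet_derivative[OF fd Dg])
qed

lemma endomorphism_on_ad:
  fixes f :: "'v::real_normed_vector ^ 'n::finite \<Rightarrow> 'v" and \<sigma> :: "'n \<Rightarrow> 'N::finite \<Rightarrow> 'N"
  assumes fd: "finite_dimensional TYPE('v)" and f: "linear f"
  shows "endomorphism_on (homogeneous_polynomial_maps d) (ad \<sigma> f)"
proof (rule endomorphism_onI)
  have fdn: "finite_dimensional TYPE('v ^ 'n)" by (rule finite_dimensional_vec[OF fd])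
  note D = homogeneous_polynomial_maps_has_derivative[OF fdn]
  show "ad \<sigma> f g \<in> homogeneous_polynomial_maps d" if g: "g \<in> homogeneous_polynomial_maps d" for g
  proof -
    have "(\<lambda>X. f (regular_network \<sigma> g X)) - (\<lambda>X. frechet_derivative g (at X) (regular_network \<sigma> f X))
        \<in> homogeneous_polynomial_maps d"
      by (rule subspace_diff[OF subspace_homogeneous_polynomial_maps
            homogeneous_polynomial_maps_postcompose[OF f regular_network_homogeneous[OF g]]
            homogeneous_polynomial_maps_derivative[OF fdn linear_regular_network[OF f] g]])
    then show ?thesis unfolding ad_eq[OF fd f g] by (simp only: fun_diff_def)
  qed
  show "ad \<sigma> f (g + h) = ad \<sigma> f g + ad \<sigma> f h"
    if g: "g \<in> homogeneous_polynomial_maps d" and h: "h \<in> homogeneous_polynomial_maps d" for g h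
  proof -
    have "frechet_derivative (g + h) (at X)
        = (\<lambda>v. frechet_derivative g (at X) v + frechet_derivative h (at X) v)" for X
      using frechet_derivative_eqI[OF has_derivative_add[OF D[OF g] D[OF h]]]
      by (simp only: plus_fun_def)
    moreover have "regular_network \<sigma> (g + h) X = regular_network \<sigma> g X + regular_network \<sigma> h X" for X
      by (simp add: regular_network_def vec_eq_iff)
    ultimately show ?thesis
      unfolding ad_eq[OF fd f g] ad_eq[OF fd f h]
        ad_eq[OF fd f subspace_add[OF subspace_homogeneous_polynomial_maps g h]]
      by (auto simp: linear_add[OF f])
  qed
  show "ad \<sigma> f (c *\<^sub>R g) = c *\<^sub>R ad \<sigma> f g" if g: "g \<in> homogeneous_polynomial_maps d" for c g
  proof -
    have "frechet_derivative (c *\<^sub>R g) (at X) = (\<lambda>v. c *\<^sub>R frechet_derivative g (at X) v)" for X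
      using frechet_derivative_eqI[OF has_derivative_scaleR_right[OF D[OF g]]]
      by (simp only: scaleR_fun_def)
    moreover have "regular_network \<sigma> (c *\<^sub>R g) X = c *\<^sub>R regular_network \<sigma> g X" for X
      by (simp add: regular_network_def vec_eq_iff scaleR_fun_def)
    ultimately show ?thesis
      unfolding ad_eq[OF fd f g] ad_eq[OF fd f subspace_scale[OF subspace_homogeneous_polynomial_maps g]]
      by (simp only: linear_scale[OF f] scaleR_fun_def scaleR_diff_right)
  qed
qed

lemma sigma_tilde:
  assumes sg: "semigroup_of_maps \<sigma>"
  shows "\<sigma> (sigma_tilde \<sigma> j k) = \<sigma> j \<circ> \<sigma> k"
proof -
  have "\<exists>!l. \<sigma> l = \<sigma> j \<circ> \<sigma> k"
    using sg unfolding semigroup_of_maps_def by metis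
  then show ?thesis unfolding sigma_tilde_def by (rule theI')
qed

text \<open>
  Cell \<open>i\<close> sees, through its \<open>j\<close>-th input, the cell \<open>\<sigma> j i\<close>, whose inputs are the cells
  \<open>\<sigma> l (\<sigma> j i) = \<sigma> (sigma_tilde \<sigma> l j) i\<close>, so they are again among the inputs of cell \<open>i\<close>. This is where
  the semigroup property enters.
\<close>

lemma regular_network_cell_input:
  assumes "\<And>j k. \<sigma> (sigma_tilde \<sigma> j k) = \<sigma> j \<circ> \<sigma> k"
  shows "regular_network \<sigma> g (cell_input \<sigma> i x) = cell_input \<sigma> i (gamma \<sigma> g x)"
proof -
  have "A_map \<sigma> j (cell_input \<sigma> i x) = cell_input \<sigma> (\<sigma> j i) x" for j
    by (simp add: A_map_def cell_input_def vec_eq_iff assms)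
  then have "regular_network \<sigma> g (cell_input \<sigma> i x) = (\<chi> j. g (cell_input \<sigma> (\<sigma> j i) x))"
    by (simp add: regular_network_def)
  also have "\<dots> = cell_input \<sigma> i (gamma \<sigma> g x)"
    by (simp add: gamma_eq_cell_input) (simp add: cell_input_def)
  finally show ?thesis .
qed

text \<open>
  By the chain rule, the \<open>i\<close>-th component of the derivative of \<open>\<gamma> g\<close> is the derivative of \<open>g\<close> at the
  input of cell \<open>i\<close>. The previous lemma exchanges the network on \<open>V^n\<close> with the one on \<open>V^N\<close>.
\<close>

lemma gamma_ad:
  fixes f g :: "'v::real_normed_vector ^ 'n::finite \<Rightarrow> 'v" and \<sigma> :: "'n \<Rightarrow> 'N::finite \<Rightarrow> 'N"
  assumes fd: "finite_dimensional TYPE('v)" and sg: "\<And>j k. \<sigma> (sigma_tilde \<sigma> j k) = \<sigma> j \<circ> \<sigma> k"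
    and f: "linear f" and g: "g \<in> homogeneous_polynomial_maps d"
  shows "gamma \<sigma> (ad \<sigma> f g) = linear_bracket (gamma \<sigma> f) (gamma \<sigma> g)"
proof
  fix x :: "'v ^ 'N"
  have fdn: "finite_dimensional TYPE('v ^ 'n)" and fdN: "finite_dimensional TYPE('v ^ 'N)"
    by (rule finite_dimensional_vec[OF fd])+
  let ?D = "\<lambda>i. frechet_derivative g (at (cell_input \<sigma> i x))"
  have "((\<lambda>x. axis i (g (cell_input \<sigma> i x))) has_derivative (\<lambda>h. axis i (?D i (cell_input \<sigma> i h)))) (at x)"
    for i :: 'N
  proof -
    have "(cell_input \<sigma> i has_derivative cell_input \<sigma> i) (at x)"
      by (rule bounded_linear_imp_has_derivative[OF bounded_linear_finite_dimensional[OF fdN linear_cell_input]])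
    from has_derivative_compose[OF this homogeneous_polynomial_maps_has_derivative[OF fdn g]]
    show ?thesis
      by (rule bounded_linear.has_derivative[OF bounded_linear_finite_dimensional[OF fd linear_axis]])
  qed
  then have "((\<lambda>x. \<Sum>i\<in>UNIV. axis i (g (cell_input \<sigma> i x))) has_derivative
      (\<lambda>h. \<Sum>i\<in>UNIV. axis i (?D i (cell_input \<sigma> i h)))) (at x)"
    by (rule has_derivative_sum)
  moreover have "(\<Sum>i\<in>UNIV. axis i (u i)) = (\<chi> i. u i)" for u :: "'N \<Rightarrow> 'v"
    using vec_eq_sum_axis[of "\<chi> i. u i"] by simp
  ultimately have "((\<lambda>x. gamma \<sigma> g x) has_derivative (\<lambda>h. \<chi> i. ?D i (cell_input \<sigma> i h))) (at x)"
    by (simp only: gamma_eq_cell_input)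
  then have D: "frechet_derivative (gamma \<sigma> g) (at x) = (\<lambda>h. \<chi> i. ?D i (cell_input \<sigma> i h))"
    by (rule frechet_derivative_eqI)
  show "gamma \<sigma> (ad \<sigma> f g) x = linear_bracket (gamma \<sigma> f) (gamma \<sigma> g) x"
    unfolding linear_bracket_def D ad_eq[OF fd f g]
    by (simp add: vec_eq_iff gamma_eq_cell_input[of \<sigma> f] gamma_eq_cell_input[of \<sigma> "\<lambda>X. _ X - _ X"]
        regular_network_cell_input[OF sg])
qed

section \<open>Descending to the quotient\<close>

text \<open>
  \<open>\<Phi>\<close> identifies \<open>W / (W \<inter> K)\<close> with \<open>\<Phi> ` W\<close>, where both operators act as \<open>R\<close>.
\<close>

lemma descend_to_same_of_intertwined:
  assumes W: "subspace W" and \<Phi>: "linear \<Phi>" and K: "\<And>x. x \<in> W \<Longrightarrow> x \<in> K \<longleftrightarrow> \<Phi> x = 0"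
    and T: "endomorphism_on W T" and T': "endomorphism_on W T'" and "R 0 = 0"
    and \<Phi>T: "\<And>x. x \<in> W \<Longrightarrow> \<Phi> (T x) = R (\<Phi> x)" and \<Phi>T': "\<And>x. x \<in> W \<Longrightarrow> \<Phi> (T' x) = R (\<Phi> x)"
  shows "descend_to_same W K T T'"
  unfolding descend_to_same_def
proof (intro conjI ballI)
  have desc: "descends W K U"
    if U: "endomorphism_on W U" and "\<And>x. x \<in> W \<Longrightarrow> \<Phi> (U x) = R (\<Phi> x)" for U
    using that K \<open>R 0 = 0\<close> endomorphism_onD(1)[OF U] by (auto simp: descends_def)
  show "descends W K T" by (rule desc[OF T \<Phi>T])
  show "descends W K T'" by (rule desc[OF T' \<Phi>T'])
  fix C assume "C \<in> W // congruence_mod W K"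
  then have C: "C \<subseteq> W" by (auto simp: quotient_def congruence_mod_def)
  have "congruence_mod W K `` {T x} = congruence_mod W K `` {T' x}" if "x \<in> C" for x
  proof -
    have x: "x \<in> W" using C that by blast
    then have TW: "T x \<in> W" "T' x \<in> W" using endomorphism_onD(1)[OF T] endomorphism_onD(1)[OF T'] by blast+
    have "T x - y \<in> K \<longleftrightarrow> T' x - y \<in> K" if "y \<in> W" for y
      using K[OF subspace_diff[OF W TW(1) that]] K[OF subspace_diff[OF W TW(2) that]]
      by (simp add: linear_diff[OF \<Phi>] \<Phi>T[OF x] \<Phi>T'[OF x])
    then show ?thesis using TW by (auto simp: congruence_mod_def)
  qed
  then show "quotient_map W K T C = quotient_map W K T' C"
    by (simp add: quotient_map_def)
qed

theorem theorem9p3: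
  fixes \<sigma> :: "'n::finite \<Rightarrow> 'N::finite \<Rightarrow> 'N"
    and f0 f0S f0N :: "'v::real_normed_vector ^ 'n \<Rightarrow> 'v"
  assumes "finite_dimensional TYPE('v)"
    and "inj \<sigma>"
    and "semigroup_of_maps \<sigma>"
    and "linear f0" and "linear f0S" and "linear f0N"
    and "gamma \<sigma> f0S = semisimple_part UNIV (gamma \<sigma> f0)"
    and "gamma \<sigma> f0N = nilpotent_part UNIV (gamma \<sigma> f0)"
  shows "\<forall>k. descend_to_same (P_space k) (ker_gamma \<sigma>)
               (semisimple_part (P_space k) (ad \<sigma> f0)) (ad \<sigma> f0S)
           \<and> descend_to_same (P_space k) (ker_gamma \<sigma>)
               (nilpotent_part (P_space k) (ad \<sigma> f0)) (ad \<sigma> f0N)"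
proof
  fix k
  note fd = assms(1) and lin = assms(4-6)
  note sg = sigma_tilde[OF assms(3)]
  have fdn: "finite_dimensional TYPE('v ^ 'n)" and fdN: "finite_dimensional TYPE('v ^ 'N)"
    by (rule finite_dimensional_vec[OF fd])+
  have fsN: "finitely_spanned (UNIV :: ('v ^ 'N) set)"
    using fdN by (auto simp: finite_dimensional_def finitely_spanned_def)
  let ?\<gamma> = "gamma \<sigma> :: ('v ^ 'n \<Rightarrow> 'v) \<Rightarrow> 'v ^ 'N \<Rightarrow> 'v ^ 'N"
  let ?W = "P_space k :: ('v ^ 'n \<Rightarrow> 'v) set"
  let ?P = "homogeneous_polynomial_maps (Suc k) :: ('v ^ 'N \<Rightarrow> 'v ^ 'N) set"
  let ?b = "\<lambda>f. linear_bracket (?\<gamma> f)"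
  have "endomorphism_on UNIV (?\<gamma> f0)"
    using linear_gamma_apply[OF lin(1)] by (simp add: endomorphism_on_UNIV_iff)
  then obtain S N where "SN_decomposition UNIV (?\<gamma> f0) S N"
    using SN_decomposition_exists[OF subspace_UNIV fsN] by metis
  with semisimple_part_eq[OF subspace_UNIV fsN this] nilpotent_part_eq[OF subspace_UNIV fsN this]
  have SN0: "SN_decomposition UNIV (?\<gamma> f0) (?\<gamma> f0S) (?\<gamma> f0N)"
    using assms(7,8) by (simp add: restrict_def)
  have W: "subspace ?W" "finitely_spanned ?W"
    by (rule subspace_homogeneous_polynomial_maps,
        rule finitely_spanned_homogeneous_polynomial_maps[OF fdn fd])
  have ad: "endomorphism_on ?W (ad \<sigma> f)" if "linear f" for f
    by (rule endomorphism_on_ad[OF fd that])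
  have \<gamma>ad: "?\<gamma> (ad \<sigma> f g) = ?b f (?\<gamma> g)" if "linear f" "g \<in> ?W" for f g
    by (rule gamma_ad[OF fd sg that])
  have inv: "?b f y \<in> ?\<gamma> ` ?W" if f: "linear f" and y: "y \<in> ?\<gamma> ` ?W" for f y
  proof -
    obtain g where g: "g \<in> ?W" "y = ?\<gamma> g" using y by blast
    then have "?b f y = ?\<gamma> (ad \<sigma> f g)" by (simp only: \<gamma>ad[OF f])
    then show ?thesis using endomorphism_onD(1)[OF ad[OF f] g(1)] by blast
  qed
  have SNb: "SN_decomposition (?\<gamma> ` ?W) (?b f0) (?b f0S) (?b f0N)"
  proof (rule SN_decomposition_restrict[OF subspace_homogeneous_polynomial_maps
        finitely_spanned_homogeneous_polynomial_maps[OF fdN fdN] SN_decomposition_linear_bracket[OF fdN SN0]])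
    show "subspace (?\<gamma> ` ?W)" by (rule linear_subspace_image[OF linear_gamma W(1)])
    show "?\<gamma> ` ?W \<subseteq> ?P" using gamma_homogeneous by blast
  qed (use inv lin in blast)+
  obtain S N where SN: "SN_decomposition ?W (ad \<sigma> f0) S N"
    using SN_decomposition_exists[OF W ad[OF lin(1)]] by metis
  note transfer = SN_decomposition_transfer[OF W linear_gamma ad[OF lin(1)] \<gamma>ad[OF lin(1)] SN SNb]
  have K: "g \<in> ker_gamma \<sigma> \<longleftrightarrow> ?\<gamma> g = 0" if "g \<in> ?W" for g
    using that polynomial_maps_smooth[OF fdn] homogeneous_subset_polynomial_maps
    by (auto simp: ker_gamma_def)
  \<comment> \<open>with \<open>\<gamma>ad\<close>, this makes the operators preserve the kernel of \<open>\<gamma>\<close>\<close>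
  have b0: "?b f 0 = 0" if "linear f" for f
    using linear_0[OF linear_gamma_apply[OF that]] frechet_derivative_eqI[OF has_derivative_const]
    by (auto simp: linear_bracket_def zero_fun_def)
  have part: "descend_to_same ?W (ker_gamma \<sigma>) (restrict T ?W) (ad \<sigma> f)"
    if "linear f" "endomorphism_on ?W T" "\<And>g. g \<in> ?W \<Longrightarrow> ?\<gamma> (T g) = ?b f (?\<gamma> g)" for T f
  proof (rule descend_to_same_of_intertwined[where R = "?b f" and \<Phi> = ?\<gamma>,
        OF W(1) linear_gamma K _ ad[OF that(1)] b0[OF that(1)] _ \<gamma>ad[OF that(1)]])
    show "endomorphism_on ?W (restrict T ?W)" by (rule endomorphism_on_cong[OF that(2) W(1)]) simp
    show "?\<gamma> (restrict T ?W g) = ?b f (?\<gamma> g)" if "g \<in> ?W" for g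
      using \<open>\<And>g. g \<in> ?W \<Longrightarrow> ?\<gamma> (T g) = ?b f (?\<gamma> g)\<close>[OF that] that by simp
  qed
  note D = SN_decompositionD[OF W SN]
  show "descend_to_same ?W (ker_gamma \<sigma>) (semisimple_part ?W (ad \<sigma> f0)) (ad \<sigma> f0S)
      \<and> descend_to_same ?W (ker_gamma \<sigma>) (nilpotent_part ?W (ad \<sigma> f0)) (ad \<sigma> f0N)"
    unfolding semisimple_part_eq[OF W SN] nilpotent_part_eq[OF W SN]
    using part[OF lin(2) D(2) transfer(1)] part[OF lin(3) D(3) transfer(2)] by blast
qed

end
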